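(* Let $\mathbb A$ be the Alexandroff double arrow space. For any cardinal $\mu>0$, $$\operatorname{ps}(\mathbb A^\mu)=\begin{cases}\omega\oplus\mu & \text{if } \mu\le\omega,\\ \mu & \text{if } \mu>\omega,\end{cases}$$ and $$\operatorname{sm}(\mathbb A^\mu)=\begin{cases}\omega\oplus 1 & \text{if } \mu<\omega,\\ \omega\oplus\omega & \text{if } \mu=\omega,\\ \mu & \text{if } \mu>\omega,\end{cases}$$ where $\mathbb A^\mu$ carries the product topology and $\oplus$ is ordinal addition.
   Context: The Alexandroff double arrow space $\mathbb A$ is $[0,1]\times\{0,1\}$ with the order topology of the lexicographic order. Games ($X$ a topological space, $Y\subseteq X$, $\beta$ an ordinal): two players, Seeker and Hider, make $\beta$ moves. At move $\alpha<\beta$, knowing all previous moves, the Seeker chooses an open set $U_\alpha\subseteq X$, and then the Hider chooses $V_\alpha\in\{U_\alpha, X\setminus U_\alpha\}$. The outcome is $W=\bigcap_{\alpha<\beta}V_\alpha$ (with $W=X$ if $\beta=0$). In the point separating game $G_\beta(X)$ the Seeker wins iff $|W|\le 1$. In the set membership game $G_\beta(Y,X)$ the Seeker wins iff $W\subseteq Y$ or $W\cap Y=\emptyset$. For a $T_0$ space $X$: $\operatorname{ps}(X)$ is the least ordinal $\beta$ such that the Seeker has a winning strategy in $G_\beta(X)$; $\operatorname{sm}(Y,X)$ is the least ordinal $\beta$ such that the Seeker has a winning strategy in $G_\beta(Y,X)$; $\operatorname{sm}(X)=\sup\{\operatorname{sm}(Y,X):Y\subseteq X\}$. *)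

theory Defs
  imports "HOL-Analysis.Analysis"
begin

unbundle cardinal_syntax
no_notation elt_set_eq (infix "=o" 50)

section \<open>The Alexandroff double arrow space\<close>

typedef double_arrow = "{0..1::real} \<times> {0, 1::nat}"
  by auto

instantiation double_arrow :: linorder
begin

definition less_eq_double_arrow :: "double_arrow \<Rightarrow> double_arrow \<Rightarrow> bool" where
  "p \<le> q \<longleftrightarrow> fst (Rep_double_arrow p) < fst (Rep_double_arrow q) \<or>
     fst (Rep_double_arrow p) = fst (Rep_double_arrow q) \<and>
     snd (Rep_double_arrow p) \<le> snd (Rep_double_arrow q)"

definition less_double_arrow :: "double_arrow \<Rightarrow> double_arrow \<Rightarrow> bool" where
  "p < q \<longleftrightarrow> fst (Rep_double_arrow p) < fst (Rep_double_arrow q) \<or>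
     fst (Rep_double_arrow p) = fst (Rep_double_arrow q) \<and>
     snd (Rep_double_arrow p) < snd (Rep_double_arrow q)"

instance
proof
  fix p q :: double_arrow
  assume "p \<le> q" "q \<le> p"
  then have "Rep_double_arrow p = Rep_double_arrow q"
    by (auto simp: less_eq_double_arrow_def intro: prod_eqI)
  then show "p = q"
    by (simp add: Rep_double_arrow_inject)
qed (auto simp: less_eq_double_arrow_def less_double_arrow_def)

end

instantiation double_arrow :: linorder_topology
begin

definition open_double_arrow :: "double_arrow set \<Rightarrow> bool" where
  "open_double_arrow = generate_topology (range (\<lambda>a. {..<a}) \<union> range (\<lambda>a. {a<..}))"

instance
  by standard (simp add: open_double_arrow_def)

end

abbreviation double_arrow_power :: "'i set \<Rightarrow> ('i \<Rightarrow> double_arrow) topology" where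
  "double_arrow_power I \<equiv> product_topology (\<lambda>_. euclidean) I"

section \<open>The games\<close>

text \<open>
  An ordinal is represented by a well-order \<open>r\<close>, considered up to \<open>=o\<close>; the moves of a game of
  that length are indexed by \<open>Field r\<close>. The move of the Seeker at \<open>\<alpha>\<close> is \<open>\<sigma> \<alpha> h\<close>, where \<open>h\<close>
  is the sequence of all earlier moves of both players, as a function that is
  \<open>undefined\<close> outside the predecessors of \<open>\<alpha>\<close>. The set \<open>P\<close> of sets is the winning condition on
  the outcome.
\<close>

definition consistent_play ::
  "'a topology \<Rightarrow> 'b rel \<Rightarrow> ('b \<Rightarrow> ('b \<Rightarrow> 'a set \<times> 'a set) \<Rightarrow> 'a set) \<Rightarrow>
     ('b \<Rightarrow> 'a set) \<Rightarrow> ('b \<Rightarrow> 'a set) \<Rightarrow> bool" where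
  "consistent_play X r \<sigma> U V \<longleftrightarrow>
     (\<forall>\<alpha>\<in>Field r. U \<alpha> = \<sigma> \<alpha> (restrict (\<lambda>\<gamma>. (U \<gamma>, V \<gamma>)) (underS r \<alpha>)) \<and>
                   V \<alpha> \<in> {U \<alpha>, topspace X - U \<alpha>})"

definition game_outcome :: "'a topology \<Rightarrow> 'b rel \<Rightarrow> ('b \<Rightarrow> 'a set) \<Rightarrow> 'a set" where
  "game_outcome X r V = topspace X \<inter> (\<Inter>\<alpha>\<in>Field r. V \<alpha>)"

definition seeker_wins :: "'a topology \<Rightarrow> 'a set set \<Rightarrow> 'b rel \<Rightarrow> bool" where
  "seeker_wins X P r \<longleftrightarrow>
     (\<exists>\<sigma>. (\<forall>\<alpha>\<in>Field r. \<forall>h. openin X (\<sigma> \<alpha> h)) \<and>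
          (\<forall>U V. consistent_play X r \<sigma> U V \<longrightarrow> game_outcome X r V \<in> P))"

definition separating_sets :: "'a set set" where
  "separating_sets = {W. finite W \<and> card W \<le> 1}"

definition deciding_sets :: "'a set \<Rightarrow> 'a set set" where
  "deciding_sets Y = {W. W \<subseteq> Y \<or> W \<inter> Y = {}}"

section \<open>The ordinal invariants\<close>

definition least_ordinal :: "('b rel \<Rightarrow> bool) \<Rightarrow> 'b rel" where
  "least_ordinal Q = (SOME r. Well_order r \<and> Q r \<and> (\<forall>s. Well_order s \<and> Q s \<longrightarrow> r \<le>o s))"

text \<open>
  The invariants are represented by well-orders of sets of subsets of the space. For a \<open>T\<^sub>0\<close> space
  this is large enough, since the Seeker wins by playing all open sets one after
  the other; the lemmas \<open>ps_least\<close>, \<open>sm_in_least\<close> and \<open>sm_least\<close> below show that the values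
  are least among all ordinals, whatever type they are represented on.
\<close>

definition ps :: "'a topology \<Rightarrow> 'a set rel" where
  "ps X = least_ordinal (seeker_wins X separating_sets)"

definition sm_in :: "'a set \<Rightarrow> 'a topology \<Rightarrow> 'a set rel" where
  "sm_in Y X = least_ordinal (seeker_wins X (deciding_sets Y))"

definition sm :: "'a topology \<Rightarrow> 'a set rel" where
  "sm X = least_ordinal (\<lambda>r. \<forall>Y. Y \<subseteq> topspace X \<longrightarrow> sm_in Y X \<le>o r)"

definition ordinal_sum :: "'a rel \<Rightarrow> 'b rel \<Rightarrow> ('a + 'b) rel" where
  "ordinal_sum r s =
     map_prod Inl Inl ` r \<union> map_prod Inr Inr ` s \<union> (Inl ` Field r) \<times> (Inr ` Field s)"

lemma least_ordinal:
  fixes r0 :: "'b rel"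
  assumes "Well_order r0" "Q r0"
  shows "Well_order (least_ordinal Q) \<and> Q (least_ordinal Q) \<and>
    (\<forall>s. Well_order s \<and> Q s \<longrightarrow> least_ordinal Q \<le>o s)"
proof -
  have "r0 \<in> {r. Well_order r \<and> Q r}"
    using assms by simp
  from wf_ordLess[unfolded wf_eq_minimal, rule_format, OF this]
  obtain r where r: "r \<in> {r. Well_order r \<and> Q r}"
    and min: "\<And>s. s <o r \<Longrightarrow> s \<notin> {r. Well_order r \<and> Q r}"
    by blast
  have "r \<le>o s" if "Well_order s" "Q s" for s :: "'b rel"
  proof -
    have "\<not> s <o r"
      using min[of s] that by blast
    then show ?thesis
      using r that not_ordLess_iff_ordLeq[of r s] by blast
  qed
  with r have "\<exists>r. Well_order r \<and> Q r \<and> (\<forall>s. Well_order s \<and> Q s \<longrightarrow> r \<le>o s)"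
    by (intro exI[of _ r]) simp
  then show ?thesis
    unfolding least_ordinal_def by (rule someI_ex)
qed

lemma seeker_wins_ordIso:
  fixes r :: "'b rel" and r' :: "'c rel"
  assumes "r =o r'" and "seeker_wins X P r"
  shows "seeker_wins X P r'"
proof -
  obtain f where wo: "Well_order r" "Well_order r'" and f: "iso r r' f"
    using assms(1) unfolding ordIso_def by auto
  have bij: "bij_betw f (Field r) (Field r')"
    using f by (simp add: iso_def)
  define g where "g = the_inv_into (Field r) f"
  have gf: "g (f a) = a" if "a \<in> Field r" for a
    using that bij by (simp add: g_def the_inv_into_f_f bij_betw_def)
  have g: "g b \<in> Field r" "f (g b) = b" if "b \<in> Field r'" for b
    using that bij unfolding g_def
    by (auto simp: f_the_inv_into_f bij_betw_def intro: the_inv_into_into)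
  have under: "f c \<in> underS r' (f a)" if "a \<in> Field r" "c \<in> underS r a" for a c
  proof -
    have "f ` underS r a = underS r' (f a)"
      using f wo that(1) by (metis bij_betw_def embed_underS iso_def)
    with that show ?thesis by auto
  qed
  obtain \<sigma> where op: "\<And>\<alpha> h. \<alpha> \<in> Field r \<Longrightarrow> openin X (\<sigma> \<alpha> h)"
    and win: "\<And>U V. consistent_play X r \<sigma> U V \<Longrightarrow> game_outcome X r V \<in> P"
    using assms(2) unfolding seeker_wins_def by blast
  define \<sigma>' where "\<sigma>' b h = \<sigma> (g b) (restrict (\<lambda>c. h (f c)) (underS r (g b)))" for b h
  have "game_outcome X r' V \<in> P" if play: "consistent_play X r' \<sigma>' U V" for U V
  proof -
    have "consistent_play X r \<sigma> (U \<circ> f) (V \<circ> f)"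
      unfolding consistent_play_def
    proof
      fix a assume a: "a \<in> Field r"
      then have fa: "f a \<in> Field r'"
        using bij by (auto simp: bij_betw_def)
      have eq: "restrict (\<lambda>c. restrict (\<lambda>\<gamma>. (U \<gamma>, V \<gamma>)) (underS r' (f a)) (f c)) (underS r a)
          = restrict (\<lambda>\<gamma>. ((U \<circ> f) \<gamma>, (V \<circ> f) \<gamma>)) (underS r a)"
        using under[OF a] by (intro restrict_ext) auto
      show "(U \<circ> f) a = \<sigma> a (restrict (\<lambda>\<gamma>. ((U \<circ> f) \<gamma>, (V \<circ> f) \<gamma>)) (underS r a)) \<and>
        (V \<circ> f) a \<in> {(U \<circ> f) a, topspace X - (U \<circ> f) a}"
        using play fa eq gf[OF a] unfolding consistent_play_def \<sigma>'_def by auto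
    qed
    then have "game_outcome X r (V \<circ> f) \<in> P"
      by (rule win)
    moreover have "Field r' = f ` Field r"
      using bij by (simp add: bij_betw_def)
    ultimately show ?thesis
      by (simp add: game_outcome_def image_image)
  qed
  moreover have "openin X (\<sigma>' b h)" if "b \<in> Field r'" for b h
    using op g that by (simp add: \<sigma>'_def)
  ultimately show ?thesis
    unfolding seeker_wins_def by blast
qed

text \<open>A least ordinal among those represented on one type is least among all ordinals.\<close>

lemma least_all_types:
  fixes r :: "'b rel" and s :: "'c rel"
  assumes r: "Well_order r" and least: "\<And>s :: 'b rel. Well_order s \<Longrightarrow> Q s \<Longrightarrow> r \<le>o s"
    and s: "Well_order s" and Q: "\<And>s' :: 'b rel. s =o s' \<Longrightarrow> Q s'"
  shows "r \<le>o s"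
proof (rule ccontr)
  assume "\<not> r \<le>o s"
  then have "s <o r"
    using r s by (simp add: not_ordLeq_iff_ordLess)
  then obtain a where a: "s =o Restr r (underS r a)" "a \<in> Field r"
    using ordLess_iff_ordIso_Restr[OF r s] by blast
  have "Well_order (Restr r (underS r a))"
    using a(1) by (simp add: ordIso_def)
  then have "r \<le>o Restr r (underS r a)"
    using least Q a(1) by blast
  then show False
    using underS_Restr_ordLess[of r a] r a(2) not_ordLess_ordLeq by blast
qed

lemma seeker_wins_open_sets:
  assumes "t0_space X"
  shows "seeker_wins X separating_sets (card_of {U. openin X U})"
proof -
  have "game_outcome X (card_of {U. openin X U}) V \<in> separating_sets"
    if play: "consistent_play X (card_of {U. openin X U}) (\<lambda>\<alpha> h. if openin X \<alpha> then \<alpha> else {}) U V" for U V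
  proof -
    let ?W = "game_outcome X (card_of {U. openin X U}) V"
    have V: "V \<alpha> \<in> {\<alpha>, topspace X - \<alpha>}" if "openin X \<alpha>" for \<alpha>
      using play that unfolding consistent_play_def by (auto simp: Field_card_of)
    have "x = y" if xy: "x \<in> ?W" "y \<in> ?W" for x y
    proof (rule ccontr)
      assume "x \<noteq> y"
      moreover have "x \<in> topspace X" "y \<in> topspace X"
        using xy by (auto simp: game_outcome_def)
      ultimately obtain U where U: "openin X U" "x \<notin> U \<longleftrightarrow> y \<in> U"
        using assms unfolding t0_space_def by metis
      have "x \<in> V U" "y \<in> V U"
        using xy U(1) by (auto simp: game_outcome_def Field_card_of)
      then show False
        using V[OF U(1)] U(2) by auto
    qed
    then have "?W = {} \<or> (\<exists>x. ?W = {x})"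
      by blast
    then show ?thesis
      unfolding separating_sets_def by auto
  qed
  then show ?thesis
    unfolding seeker_wins_def
    by (intro exI[of _ "\<lambda>\<alpha> h. if openin X \<alpha> then \<alpha> else {}"]) auto
qed

lemma seeker_wins_mono:
  assumes "seeker_wins X P r" "P \<subseteq> Q"
  shows "seeker_wins X Q r"
proof -
  obtain \<sigma> where "\<forall>\<alpha>\<in>Field r. \<forall>h. openin X (\<sigma> \<alpha> h)"
    and win: "\<forall>U V. consistent_play X r \<sigma> U V \<longrightarrow> game_outcome X r V \<in> P"
    using assms(1) unfolding seeker_wins_def by (elim exE conjE)
  moreover have "\<forall>U V. consistent_play X r \<sigma> U V \<longrightarrow> game_outcome X r V \<in> Q"
    using win subsetD[OF assms(2)] by simp
  ultimately show ?thesis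
    unfolding seeker_wins_def by (intro exI[of _ \<sigma>] conjI)
qed

lemma separating_subset_deciding: "separating_sets \<subseteq> deciding_sets Y"
proof
  fix W :: "'a set"
  assume "W \<in> separating_sets"
  then have "finite W" "card W \<le> 1"
    by (simp_all add: separating_sets_def)
  then have "finite W" "card W = 0 \<or> card W = 1"
    by linarith+
  then have "W = {} \<or> (\<exists>x. W = {x})"
    by (metis card_0_eq card_1_singletonE)
  then show "W \<in> deciding_sets Y"
    unfolding deciding_sets_def by auto
qed

lemma ps_least:
  assumes "t0_space X"
  shows "Well_order (ps X)" "seeker_wins X separating_sets (ps X)"
    "\<And>s :: 'c rel. Well_order s \<Longrightarrow> seeker_wins X separating_sets s \<Longrightarrow> ps X \<le>o s"
proof -
  note * = least_ordinal[of _ "seeker_wins X separating_sets", OF card_of_Well_order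
      seeker_wins_open_sets[OF assms], folded ps_def]
  show wo: "Well_order (ps X)" and "seeker_wins X separating_sets (ps X)"
    using *[THEN conjunct1] *[THEN conjunct2, THEN conjunct1] .
  show "ps X \<le>o s" if "Well_order s" "seeker_wins X separating_sets s" for s :: "'c rel"
  proof (rule least_all_types[OF wo _ \<open>Well_order s\<close>, of "seeker_wins X separating_sets"])
    show "ps X \<le>o s" if "Well_order s" "seeker_wins X separating_sets s" for s :: "'a set rel"
      using *[THEN conjunct2, THEN conjunct2, rule_format, OF conjI[OF that]] .
    show "seeker_wins X separating_sets s'" if "s =o s'" for s' :: "'a set rel"
      using seeker_wins_ordIso[OF that \<open>seeker_wins X separating_sets s\<close>] .
  qed
qed

lemma sm_in_least:
  assumes "t0_space X"
  shows "Well_order (sm_in Y X)" "seeker_wins X (deciding_sets Y) (sm_in Y X)"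
    "\<And>s :: 'c rel. Well_order s \<Longrightarrow> seeker_wins X (deciding_sets Y) s \<Longrightarrow> sm_in Y X \<le>o s"
proof -
  note * = least_ordinal[of _ "seeker_wins X (deciding_sets Y)", OF card_of_Well_order
      seeker_wins_mono[OF seeker_wins_open_sets[OF assms] separating_subset_deciding],
      folded sm_in_def]
  show wo: "Well_order (sm_in Y X)" and "seeker_wins X (deciding_sets Y) (sm_in Y X)"
    using *[THEN conjunct1] *[THEN conjunct2, THEN conjunct1] .
  show "sm_in Y X \<le>o s" if "Well_order s" "seeker_wins X (deciding_sets Y) s" for s :: "'c rel"
  proof (rule least_all_types[OF wo _ \<open>Well_order s\<close>, of "seeker_wins X (deciding_sets Y)"])
    show "sm_in Y X \<le>o s" if "Well_order s" "seeker_wins X (deciding_sets Y) s" for s :: "'a set rel"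
      using *[THEN conjunct2, THEN conjunct2, rule_format, OF conjI[OF that]] .
    show "seeker_wins X (deciding_sets Y) s'" if "s =o s'" for s' :: "'a set rel"
      using seeker_wins_ordIso[OF that \<open>seeker_wins X (deciding_sets Y) s\<close>] .
  qed
qed

lemma sm_least:
  assumes "t0_space X"
  shows "Well_order (sm X)" "\<And>Y. Y \<subseteq> topspace X \<Longrightarrow> sm_in Y X \<le>o sm X"
    "\<And>s :: 'c rel. Well_order s \<Longrightarrow> (\<And>Y. Y \<subseteq> topspace X \<Longrightarrow> sm_in Y X \<le>o s) \<Longrightarrow> sm X \<le>o s"
proof -
  let ?Q = "\<lambda>r :: 'a set rel. \<forall>Y. Y \<subseteq> topspace X \<longrightarrow> sm_in Y X \<le>o r"
  have "?Q (ps X)"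
    using sm_in_least(3)[OF assms ps_least(1)[OF assms]
      seeker_wins_mono[OF ps_least(2)[OF assms] separating_subset_deciding]]
    by (intro allI impI)
  note * = least_ordinal[of _ ?Q, OF ps_least(1)[OF assms] this, folded sm_def]
  show wo: "Well_order (sm X)" and "\<And>Y. Y \<subseteq> topspace X \<Longrightarrow> sm_in Y X \<le>o sm X"
    using *[THEN conjunct1] *[THEN conjunct2, THEN conjunct1, rule_format] .
  show "sm X \<le>o s" if "Well_order s" and bound: "\<And>Y. Y \<subseteq> topspace X \<Longrightarrow> sm_in Y X \<le>o s" for s :: "'c rel"
  proof (rule least_all_types[OF wo _ \<open>Well_order s\<close>, of ?Q])
    show "sm X \<le>o s" if "Well_order s" "?Q s" for s :: "'a set rel"
      using *[THEN conjunct2, THEN conjunct2, rule_format, OF conjI[OF that]] .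
    show "?Q s'" if "s =o s'" for s' :: "'a set rel"
      by (intro allI impI ordLeq_ordIso_trans[OF bound that])
  qed
qed

end

theory Submission
  imports Defs
begin

text \<open>
  Upper bounds: \<open>\<omega>\<close> moves per coordinate, bisecting at all rationals, pin down the
  real part of that coordinate, and one later move then separates the two points over it. For
  countable \<open>I\<close> all bisections fit into the first \<open>\<omega>\<close> moves; for uncountable \<open>I\<close>
  each coordinate gets a block of length \<open>\<omega> + 1\<close>, and \<open>|I|\<close> such blocks still have order
  type \<open>|I|\<close>. For finite \<open>I\<close> only finitely many points are left after \<open>\<omega>\<close> moves, so a
  single open set decides membership.

  Lower bounds: during the first \<open>\<omega>\<close> moves the Hider keeps a product of shrinking intervals
  and thereby a full fibre, a copy of the power \<open>{0, 1}\<close> to the \<open>I\<close>. For finite \<open>I\<close>,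
  keeping the larger half at each further move leaves two points after fewer than \<open>|I|\<close> moves;
  for infinite \<open>I\<close>, finitely many further moves fix only finitely many coordinates. In a game
  shorter than an uncountable \<open>|I|\<close>, the Hider fixes finitely many coordinates per move.
\<close>

section \<open>The double arrow space\<close>

text \<open>For infinite \<open>I\<close> an upper bound for \<open>ps\<close> and a lower bound for
  \<open>sm\<close> meet, because the Seeker who separates points also decides every set; only
  finite \<open>I\<close> needs separate estimates for both invariants. A lower bound omega + t has
  to exclude all smaller lengths. These are finite or of the form omega + k, so by padding with idle
  moves it is enough to refute omega + k, and backward induction on outcomes removes the finite
  tail.

  In the first omega moves every point of the double arrow has only one-sided neighbourhoods, so the
  Hider cannot hold on to a point and both of its sides. Instead the point is abandoned for an
  interval beside it. A limit strictly inside all these intervals leaves the two points over it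
  together. Conversely, the move that splits two such points comes after a full bisection, because
  its cut lies at the real number which the bisection determines.\<close>

definition pos :: "double_arrow \<Rightarrow> real" where
  "pos p = fst (Rep_double_arrow p)"

definition arrow :: "real \<Rightarrow> nat \<Rightarrow> double_arrow" where
  "arrow t k = Abs_double_arrow (t, k)"

lemma pos_bounds: "0 \<le> pos p" "pos p \<le> 1"
  using Rep_double_arrow[of p] by (auto simp: pos_def)

lemma Rep_arrow: "t \<in> {0..1} \<Longrightarrow> k \<in> {0, 1} \<Longrightarrow> Rep_double_arrow (arrow t k) = (t, k)"
  unfolding arrow_def by (subst Abs_double_arrow_inverse) auto

lemma pos_arrow [simp]: "t \<in> {0..1} \<Longrightarrow> k \<in> {0, 1} \<Longrightarrow> pos (arrow t k) = t"
  by (simp add: pos_def Rep_arrow)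

lemma arrow_cases [case_names lower upper]:
  obtains t where "0 \<le> t" "t \<le> 1" "p = arrow t 0" | t where "0 \<le> t" "t \<le> 1" "p = arrow t 1"
proof -
  have "snd (Rep_double_arrow p) \<in> {0, 1}"
    using Rep_double_arrow[of p] by auto
  moreover have "p = arrow (pos p) (snd (Rep_double_arrow p))"
    by (simp add: arrow_def pos_def Rep_double_arrow_inverse)
  ultimately show thesis
    using that pos_bounds[of p] by (metis insertE singletonD)
qed

lemma arrow_less_iff [simp]:
  assumes "t \<in> {0..1}" "k \<in> {0, 1}" "t' \<in> {0..1}" "k' \<in> {0, 1}"
  shows "arrow t k < arrow t' k' \<longleftrightarrow> t < t' \<or> t = t' \<and> k < k'"
  using assms by (simp add: less_double_arrow_def Rep_arrow)

lemma arrow_le_iff [simp]: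
  assumes "t \<in> {0..1}" "k \<in> {0, 1}" "t' \<in> {0..1}" "k' \<in> {0, 1}"
  shows "arrow t k \<le> arrow t' k' \<longleftrightarrow> t < t' \<or> t = t' \<and> k \<le> k'"
  using assms by (simp add: less_eq_double_arrow_def Rep_arrow)

lemma arrow_eq_iff [simp]:
  assumes "t \<in> {0..1}" "k \<in> {0, 1}" "t' \<in> {0..1}" "k' \<in> {0, 1}"
  shows "arrow t k = arrow t' k' \<longleftrightarrow> t = t' \<and> k = k'"
  using assms Rep_arrow by (metis prod.inject)

lemma less_arrow_if_pos_less:
  assumes "pos p < t" "t \<le> 1" "k \<in> {0, 1}"
  shows "p < arrow t k"
  using assms by (cases p rule: arrow_cases) auto

lemma arrow_less_if_less_pos:
  assumes "t < pos p" "0 \<le> t" "k \<in> {0, 1}"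
  shows "arrow t k < p"
  using assms by (cases p rule: arrow_cases) auto

lemma arrow_interval_iff:
  assumes "a \<in> {0..1}" "b \<in> {0..1}"
  shows "p \<in> {arrow a 1..arrow b 0} \<longleftrightarrow>
    (a < pos p \<or> p = arrow a 1) \<and> (pos p < b \<or> p = arrow b 0)"
  using assms by (cases p rule: arrow_cases) auto

text \<open>A neighbourhood of a lower point contains an order interval to its left, one of an upper
  point an interval to its right. The new interval is placed strictly on that side and does not
  contain \<open>p\<close> itself; lying in \<open>N\<close> is all that matters.\<close>

lemma shrinking_interval:
  assumes N: "open N" "p \<in> N" and p: "p \<in> {arrow a 1..arrow b 0}"
    and ab: "0 \<le> a" "a < b" "b \<le> 1"
  obtains a' b' where "a < a'" "a' < b'" "b' < b" "{arrow a' 1..arrow b' 0} \<subseteq> N"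
proof (cases p rule: arrow_cases)
  case (lower t)
  have le: "a < t" "t \<le> b"
    using p ab lower by auto
  then have "arrow a 1 < p"
    using lower ab by auto
  then obtain c where c: "c < p" "{c<..p} \<subseteq> N"
    using open_left[OF N] by blast
  have "pos c < t"
    using c(1) lower by (cases c rule: arrow_cases) auto
  then have m: "max a (pos c) < t"
    using le by simp
  obtain a' where a': "max a (pos c) < a'" "a' < t"
    using dense[OF m] by blast
  obtain b' where b': "a' < b'" "b' < t"
    using dense[OF a'(2)] by blast
  have "c < arrow a' 1"
    using a' lower by (intro less_arrow_if_pos_less) auto
  moreover have "arrow b' 0 \<le> p"
    using lower a' b' ab by auto
  ultimately have "{arrow a' 1..arrow b' 0} \<subseteq> {c<..p}"
    by auto
  then show thesis
    using that[of a' b'] c(2) a' b' le by auto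
next
  case (upper t)
  have le: "a \<le> t" "t < b"
    using p ab upper by auto
  then have "p < arrow b 0"
    using upper ab by auto
  then obtain c where c: "p < c" "{p..<c} \<subseteq> N"
    using open_right[OF N] by blast
  have "t < pos c"
    using c(1) upper by (cases c rule: arrow_cases) auto
  then have m: "t < min b (pos c)"
    using le by simp
  obtain b' where b': "t < b'" "b' < min b (pos c)"
    using dense[OF m] by blast
  obtain a' where a': "t < a'" "a' < b'"
    using dense[OF b'(1)] by blast
  have "arrow b' 0 < c"
    using b' upper by (intro arrow_less_if_less_pos) auto
  moreover have "p \<le> arrow a' 1"
    using upper a' b' ab by auto
  ultimately have "{arrow a' 1..arrow b' 0} \<subseteq> {p..<c}"
    by auto
  then show thesis
    using that[of a' b'] c(2) a' b' le by auto
qed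

section \<open>The product topology of the powers\<close>

lemma Hausdorff_double_arrow_power: "Hausdorff_space (double_arrow_power I)"
  unfolding Hausdorff_space_product_topology by (simp add: Hausdorff_space_def separation_t2 disjnt_def)

lemma topspace_double_arrow_power: "topspace (double_arrow_power I) = I \<rightarrow>\<^sub>E UNIV"
  by simp

lemma openin_coordinate:
  assumes "i \<in> I" "open N"
  shows "openin (double_arrow_power I) {x \<in> topspace (double_arrow_power I). x i \<in> N}"
  using openin_continuous_map_preimage[OF continuous_map_product_projection[OF assms(1)], of "\<lambda>_. euclidean" N]
    assms(2) by simp

section \<open>Well-orders\<close>

lemma Field_ordinal_sum [simp]: "Field (ordinal_sum r s) = Inl ` Field r \<union> Inr ` Field s"
proof
  show "Field (ordinal_sum r s) \<subseteq> Inl ` Field r \<union> Inr ` Field s"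
    unfolding ordinal_sum_def Field_def by auto
next
  have "Inl x \<in> Field (ordinal_sum r s)" if "x \<in> Field r" for x
    using that unfolding ordinal_sum_def Field_def by (auto simp: image_iff) 
  moreover have "Inr x \<in> Field (ordinal_sum r s)" if "x \<in> Field s" for x
    using that unfolding ordinal_sum_def Field_def by (auto simp: image_iff) 
  ultimately show "Inl ` Field r \<union> Inr ` Field s \<subseteq> Field (ordinal_sum r s)" by auto
qed

lemma ordinal_sum_iff [simp]:
  "(Inl x, Inl y) \<in> ordinal_sum r s \<longleftrightarrow> (x, y) \<in> r"
  "(Inr u, Inr v) \<in> ordinal_sum r s \<longleftrightarrow> (u, v) \<in> s"
  "(Inl x, Inr v) \<in> ordinal_sum r s \<longleftrightarrow> x \<in> Field r \<and> v \<in> Field s"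
  "(Inr u, Inl y) \<notin> ordinal_sum r s"
  by (auto simp: ordinal_sum_def)

lemma Well_order_ordinal_sum:
  assumes "Well_order r" "Well_order s"
  shows "Well_order (ordinal_sum r s)"
proof -
  have r: "Linear_order r" and s: "Linear_order s"
    using assms by (auto simp: well_order_on_def)
  have lin: "Linear_order (ordinal_sum r s)"
    unfolding order_on_defs
  proof (intro conjI)
    show "ordinal_sum r s \<subseteq> Field (ordinal_sum r s) \<times> Field (ordinal_sum r s)"
      by (auto simp only: FieldI1 FieldI2)
    show "refl_on (Field (ordinal_sum r s)) (ordinal_sum r s)"
      using r s unfolding order_on_defs refl_on_def by auto
    show "trans (ordinal_sum r s)"
    proof (rule transI)
      fix x y z
      assume "(x, y) \<in> ordinal_sum r s" "(y, z) \<in> ordinal_sum r s"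
      moreover have "trans r" "trans s"
        using r s by (simp_all add: order_on_defs)
      ultimately show "(x, z) \<in> ordinal_sum r s"
        by (cases x; cases y; cases z; simp) (meson transD FieldI1 FieldI2)+
    qed
    show "antisym (ordinal_sum r s)"
    proof (rule antisymI)
      fix x y
      assume "(x, y) \<in> ordinal_sum r s" "(y, x) \<in> ordinal_sum r s"
      moreover have "antisym r" "antisym s"
        using r s by (simp_all add: order_on_defs)
      ultimately show "x = y"
        by (cases x; cases y; simp) (meson antisymD)+
    qed
    show "total_on (Field (ordinal_sum r s)) (ordinal_sum r s)"
      unfolding total_on_def
    proof (intro ballI impI)
      fix x y
      assume "x \<in> Field (ordinal_sum r s)" "y \<in> Field (ordinal_sum r s)" "x \<noteq> y"
      moreover have "total_on (Field r) r" "total_on (Field s) s"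
        using r s by (simp_all add: order_on_defs)
      ultimately show "(x, y) \<in> ordinal_sum r s \<or> (y, x) \<in> ordinal_sum r s"
        by (cases x; cases y) (simp_all add: total_on_def image_iff)
    qed
  qed
  have "\<exists>a\<in>A. \<forall>a'\<in>A. (a, a') \<in> ordinal_sum r s"
    if A: "A \<subseteq> Field (ordinal_sum r s)" "A \<noteq> {}" for A
  proof (cases "\<exists>x. Inl x \<in> A")
    case True
    then have "Inl -` A \<noteq> {}" "Inl -` A \<subseteq> Field r"
      using A by auto
    then obtain a where a: "a \<in> Inl -` A" "\<forall>a'\<in>Inl -` A. (a, a') \<in> r"
      using assms(1)[unfolded Linear_order_Well_order_iff[OF r], rule_format, of "Inl -` A"] by blast
    moreover have "a \<in> Field r"
      using a A(1) by auto
    ultimately have "(Inl a, a') \<in> ordinal_sum r s" if "a' \<in> A" for a'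
      using A(1) that by (cases a') auto
    with a show ?thesis by auto
  next
    case False
    moreover obtain z where "z \<in> A"
      using A(2) by blast
    ultimately have "Inr -` A \<noteq> {}"
      by (cases z) auto
    moreover have "Inr -` A \<subseteq> Field s"
      using A(1) by auto
    ultimately obtain a where a: "a \<in> Inr -` A" "\<forall>a'\<in>Inr -` A. (a, a') \<in> s"
      using assms(2)[unfolded Linear_order_Well_order_iff[OF s], rule_format, of "Inr -` A"] by blast
    then have "(Inr a, a') \<in> ordinal_sum r s" if "a' \<in> A" for a'
      using False that by (cases a') auto
    with a show ?thesis by auto
  qed
  then show ?thesis
    using Linear_order_Well_order_iff[OF lin] by blast
qed

text \<open>Lets the cardinal \<open>|I|\<close> in the second summand be exchanged for
  \<open>natLeq\<close> or \<open>natLeq_on n\<close>, whose initial segments are explicit.\<close>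

lemma ordinal_sum_ordIso_right:
  assumes r: "Well_order r" and st: "s =o t"
  shows "ordinal_sum r s =o ordinal_sum r t"
proof -
  have st': "Well_order s" "Well_order t"
    using st by (auto simp: ordIso_def)
  obtain f where f: "iso s t f"
    using st by (auto simp: ordIso_def)
  note iso = iso_iff2[THEN iffD1, OF f]
  have bij: "bij_betw f (Field s) (Field t)"
    using iso by (rule conjunct1)
  have mono: "(a, b) \<in> s \<longleftrightarrow> (f a, f b) \<in> t" if "a \<in> Field s" "b \<in> Field s" for a b
    by (rule bspec[OF bspec[OF conjunct2[OF iso] that(1)] that(2)])
  have "iso (ordinal_sum r s) (ordinal_sum r t) (map_sum id f)"
    unfolding iso_iff2
  proof (intro conjI ballI)
    show "bij_betw (map_sum id f) (Field (ordinal_sum r s)) (Field (ordinal_sum r t))"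
      unfolding bij_betw_def
    proof
      show "inj_on (map_sum id f) (Field (ordinal_sum r s))"
      proof (rule inj_onI)
        fix x y
        assume "x \<in> Field (ordinal_sum r s)" "y \<in> Field (ordinal_sum r s)"
          "map_sum id f x = map_sum id f y"
        then show "x = y"
          using inj_onD[OF bij_betw_imp_inj_on[OF bij]] by (cases x; cases y) auto
      qed
      show "map_sum id f ` Field (ordinal_sum r s) = Field (ordinal_sum r t)"
        unfolding Field_ordinal_sum bij_betw_imp_surj_on[OF bij, symmetric]
        by (simp add: image_Un image_image)
    qed
    show "(a, b) \<in> ordinal_sum r s \<longleftrightarrow> (map_sum id f a, map_sum id f b) \<in> ordinal_sum r t"
      if "a \<in> Field (ordinal_sum r s)" "b \<in> Field (ordinal_sum r s)" for a b
      using that mono bij_betwE[OF bij] by (cases a; cases b) auto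
  qed
  then have "\<exists>g. iso (ordinal_sum r s) (ordinal_sum r t) g"
    by blast
  with Well_order_ordinal_sum[OF r st'(1)] Well_order_ordinal_sum[OF r st'(2)] show ?thesis
    by (simp only: ordIso_def mem_Collect_eq case_prod_conv simp_thms)
qed

section \<open>Ordinal products: one copy of \<open>s\<close> for each element of
  \<open>r\<close>\<close>

definition lexicographic :: "'b rel \<Rightarrow> 'c rel \<Rightarrow> ('b \<times> 'c) rel" where
  "lexicographic r s = {((a, b), (a', b')). a \<in> Field r \<and> a' \<in> Field r \<and> b \<in> Field s \<and>
     b' \<in> Field s \<and> ((a, a') \<in> r - Id \<or> a = a' \<and> (b, b') \<in> s)}"

lemma Field_lexicographic:
  assumes "Well_order s"
  shows "Field (lexicographic r s) = Field r \<times> Field s"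
proof
  show "Field (lexicographic r s) \<subseteq> Field r \<times> Field s"
    unfolding lexicographic_def Field_def by auto
  have "(b, b) \<in> s" if "b \<in> Field s" for b
    using assms that unfolding order_on_defs refl_on_def by auto
  then have "((a, b), (a, b)) \<in> lexicographic r s" if "a \<in> Field r" "b \<in> Field s" for a b
    using that unfolding lexicographic_def by auto
  then show "Field r \<times> Field s \<subseteq> Field (lexicographic r s)"
    by (auto intro: FieldI1)
qed

lemma Well_order_lexicographic:
  assumes r: "Well_order r" and s: "Well_order s"
  shows "Well_order (lexicographic r s)"
proof -
  note F = Field_lexicographic[OF s]
  have lr: "refl_on (Field r) r" "trans r" "antisym r" "total_on (Field r) r" "wf (r - Id)"
    using r unfolding order_on_defs by auto
  have ls: "refl_on (Field s) s" "trans s" "antisym s" "total_on (Field s) s" "wf (s - Id)"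
    using s unfolding order_on_defs by auto
  show ?thesis
    unfolding order_on_defs
  proof (intro conjI)
    show "lexicographic r s \<subseteq> Field (lexicographic r s) \<times> Field (lexicographic r s)"
      by (auto simp only: FieldI1 FieldI2)
    show "refl_on (Field (lexicographic r s)) (lexicographic r s)"
      using ls(1) unfolding F refl_on_def by (auto simp: lexicographic_def)
    show "trans (lexicographic r s)"
    proof (rule transI)
      fix x y z
      assume *: "(x, y) \<in> lexicographic r s" "(y, z) \<in> lexicographic r s"
      obtain a b a' b' a'' b'' where "x = (a, b)" "y = (a', b')" "z = (a'', b'')"
        using surj_pair by metis
      with * show "(x, z) \<in> lexicographic r s"
        using transD[OF lr(2), of a a' a''] antisymD[OF lr(3), of a a'] transD[OF ls(2), of b b' b'']
        unfolding lexicographic_def by auto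
    qed
    show "antisym (lexicographic r s)"
    proof (rule antisymI)
      fix x y
      assume *: "(x, y) \<in> lexicographic r s" "(y, x) \<in> lexicographic r s"
      obtain a b a' b' where "x = (a, b)" "y = (a', b')"
        using surj_pair by metis
      with * show "x = y"
        using antisymD[OF lr(3), of a a'] antisymD[OF ls(3), of b b']
        unfolding lexicographic_def by auto
    qed
    show "total_on (Field (lexicographic r s)) (lexicographic r s)"
      unfolding total_on_def F
    proof (intro ballI impI)
      fix x y
      assume *: "x \<in> Field r \<times> Field s" "y \<in> Field r \<times> Field s" "x \<noteq> y"
      obtain a b a' b' where "x = (a, b)" "y = (a', b')"
        using surj_pair by metis
      with * show "(x, y) \<in> lexicographic r s \<or> (y, x) \<in> lexicographic r s"
        using lr(4)[unfolded total_on_def, rule_format, of a a']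
          ls(4)[unfolded total_on_def, rule_format, of b b'] ls(1)
        by (auto simp: lexicographic_def refl_on_def)
    qed
    have "lexicographic r s - Id \<subseteq> (r - Id) <*lex*> (s - Id)"
      by (auto simp: lexicographic_def)
    then show "wf (lexicographic r s - Id)"
      using wf_lex_prod[OF lr(5) ls(5)] wf_subset by blast
  qed
qed

section \<open>Initial segments of sums\<close>

lemma ordinal_sum_empty_right:
  assumes "Well_order r"
  shows "r =o ordinal_sum r (natLeq_on 0)"
proof -
  have "iso r (ordinal_sum r (natLeq_on 0)) Inl"
    unfolding iso_iff2 by (auto simp: bij_betw_def Field_natLeq_on)
  then show ?thesis
    using Well_order_ordinal_sum[OF assms natLeq_on_Well_order[of 0]] assms
    unfolding ordIso_def by blast
qed

lemma underS_ordinal_sum_Inr: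
  "underS (ordinal_sum r s) (Inr b) = (if b \<in> Field s then Inl ` Field r else {}) \<union> Inr ` underS s b"
proof (intro set_eqI)
  fix z
  show "z \<in> underS (ordinal_sum r s) (Inr b) \<longleftrightarrow>
    z \<in> (if b \<in> Field s then Inl ` Field r else {}) \<union> Inr ` underS s b"
    by (cases z) (auto simp: underS_def)
qed

lemma underS_ordinal_sum_Inl: "underS (ordinal_sum r s) (Inl a) = Inl ` underS r a"
proof (intro set_eqI)
  fix z
  show "z \<in> underS (ordinal_sum r s) (Inl a) \<longleftrightarrow> z \<in> Inl ` underS r a"
    by (cases z) (auto simp: underS_def)
qed

lemma underS_natLeq_on: "k < n \<Longrightarrow> underS (natLeq_on n) k = {..<k}"
  by (auto simp: underS_def)

lemma underS_natLeq: "underS natLeq n = {..<n}"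
  by (auto simp: underS_def natLeq_def)

lemma Restr_ordinal_sum_underS_Inr:
  assumes "k \<in> Field t" "Restr t (underS t k) = natLeq_on k" "underS t k = {..<k}"
  shows "Restr (ordinal_sum natLeq t) (underS (ordinal_sum natLeq t) (Inr k)) =
    ordinal_sum natLeq (natLeq_on k)"
proof -
  have "(x, y) \<in> Restr (ordinal_sum natLeq t) (underS (ordinal_sum natLeq t) (Inr k)) \<longleftrightarrow>
    (x, y) \<in> ordinal_sum natLeq (natLeq_on k)" for x y
  proof -
    have *: "(u, v) \<in> t \<and> u < k \<and> v < k \<longleftrightarrow> u < k \<and> v < k \<and> u \<le> v" for u v
      using assms(2,3) by auto
    have "v \<in> Field t" if "v < k" for v
      using assms(3) that by (auto simp: underS_def intro: FieldI1)
    then show ?thesis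
      using assms(1,3) *
      by (cases x; cases y) (auto simp: underS_ordinal_sum_Inr Field_natLeq_on Field_natLeq)
  qed
  then show ?thesis by (intro set_eqI) auto
qed

text \<open>A proper initial segment ends either in the first summand, where it is finite and thus
  below omega, or at a position \<open>k\<close> of \<open>t\<close>, where it is omega + k. The
  alternative \<open>k = 0\<close> serves the finite segments, also when \<open>t\<close> is
  empty.\<close>

lemma ordLess_ordinal_sum_natLeq:
  assumes s: "s <o ordinal_sum natLeq t" and t: "t = natLeq \<or> t = natLeq_on n"
  obtains k where "k = 0 \<or> k \<in> Field t" "s \<le>o ordinal_sum natLeq (natLeq_on k)"
proof -
  have wt: "Well_order t"
    using t natLeq_Well_order natLeq_on_Well_order by auto
  have ws: "Well_order s"
    using s by (simp add: ordLess_def)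
  obtain a where a: "a \<in> Field (ordinal_sum natLeq t)"
    and s_iso: "s =o Restr (ordinal_sum natLeq t) (underS (ordinal_sum natLeq t) a)"
    using s ordLess_iff_ordIso_Restr[OF Well_order_ordinal_sum[OF natLeq_Well_order wt] ws] by blast
  show thesis
  proof (cases a)
    case (Inl j)
    let ?R = "Restr (ordinal_sum natLeq t) (underS (ordinal_sum natLeq t) a)"
    have "finite (Field ?R)"
      using finite_subset[OF Field_Restr_subset]
      by (metis Inl finite_imageI finite_lessThan underS_natLeq underS_ordinal_sum_Inl)
    moreover have "infinite (Field (ordinal_sum natLeq (natLeq_on 0)))"
      by (auto simp: Field_natLeq finite_image_iff)
    ultimately have "?R <o ordinal_sum natLeq (natLeq_on 0)"
      using s_iso Well_order_ordinal_sum[OF natLeq_Well_order natLeq_on_Well_order[of 0]]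
      by (intro finite_ordLess_infinite) (auto simp: ordIso_def)
    then show thesis
      using that[of 0] s_iso by (meson ordIso_ordLess_trans ordLess_imp_ordLeq)
  next
    case (Inr k)
    then have k: "k \<in> Field t"
      using a by auto
    have u: "underS t k = {..<k}"
      using t k underS_natLeq underS_natLeq_on Field_natLeq_on by auto
    have "Restr t (underS t k) = natLeq_on k"
      using t k unfolding u by (auto simp: natLeq_def Field_natLeq_on)
    then show thesis
      using that[of k] s_iso k Restr_ordinal_sum_underS_Inr[OF k _ u] Inr
      by (metis ordIso_imp_ordLeq)
  qed
qed

section \<open>Shortening and lengthening games\<close>

text \<open>On the additional moves the Seeker plays the empty set. Whatever the Hider answers, the
  outcome can only shrink, which a winning condition closed under subsets tolerates.\<close>

lemma seeker_wins_initial_segment: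
  assumes win: "seeker_wins X P r" and F: "Field r \<subseteq> Field s"
    and under: "\<And>a. a \<in> Field r \<Longrightarrow> underS s a = underS r a"
    and down: "\<And>W W'. W \<in> P \<Longrightarrow> W' \<subseteq> W \<Longrightarrow> W' \<in> P"
  shows "seeker_wins X P s"
proof -
  obtain \<sigma> where op: "\<forall>\<alpha>\<in>Field r. \<forall>h. openin X (\<sigma> \<alpha> h)"
    and out: "\<forall>U V. consistent_play X r \<sigma> U V \<longrightarrow> game_outcome X r V \<in> P"
    using win unfolding seeker_wins_def by blast
  define \<sigma>' where "\<sigma>' \<alpha> h = (if \<alpha> \<in> Field r then \<sigma> \<alpha> h else {})" for \<alpha> h
  have "game_outcome X s V \<in> P" if "consistent_play X s \<sigma>' U V" for U V
  proof (rule down)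
    have "consistent_play X r \<sigma> U V"
      unfolding consistent_play_def
    proof
      fix \<alpha>
      assume \<alpha>: "\<alpha> \<in> Field r"
      then have "U \<alpha> = \<sigma>' \<alpha> (restrict (\<lambda>\<gamma>. (U \<gamma>, V \<gamma>)) (underS s \<alpha>)) \<and>
          V \<alpha> \<in> {U \<alpha>, topspace X - U \<alpha>}"
        using that F unfolding consistent_play_def by blast
      then show "U \<alpha> = \<sigma> \<alpha> (restrict (\<lambda>\<gamma>. (U \<gamma>, V \<gamma>)) (underS r \<alpha>)) \<and>
          V \<alpha> \<in> {U \<alpha>, topspace X - U \<alpha>}"
        unfolding \<sigma>'_def if_P[OF \<alpha>] under[OF \<alpha>] .
    qed
    then show "game_outcome X r V \<in> P"
      using out by blast
    show "game_outcome X s V \<subseteq> game_outcome X r V"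
      using F unfolding game_outcome_def by blast
  qed
  moreover have "\<forall>\<alpha>\<in>Field s. \<forall>h. openin X (\<sigma>' \<alpha> h)"
    using op by (simp add: \<sigma>'_def)
  ultimately show ?thesis
    unfolding seeker_wins_def by blast
qed

text \<open>The shorter game is isomorphic to the game on an initial segment of \<open>s\<close>, so
  padding applies. Read backwards, a Seeker who fails at one length fails at all smaller
  ones.\<close>

lemma seeker_wins_longer:
  fixes r :: "'b rel" and s :: "'c rel"
  assumes "r \<le>o s" "seeker_wins X P r"
    and down: "\<And>W W'. W \<in> P \<Longrightarrow> W' \<subseteq> W \<Longrightarrow> W' \<in> P"
  shows "seeker_wins X P s"
proof (cases "r =o s")
  case True
  then show ?thesis
    using assms(2) seeker_wins_ordIso by blast
next
  case False
  have wo: "Well_order r" "Well_order s"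
    using assms(1) by (auto simp: ordLeq_def)
  have "r <o s"
    using assms(1) False ordLeq_iff_ordLess_or_ordIso by blast
  then obtain a where a: "a \<in> Field s" "r =o Restr s (underS s a)"
    using ordLess_iff_ordIso_Restr[OF wo(2,1)] by blast
  let ?r = "Restr s (underS s a)"
  have s: "trans s" "antisym s" "refl_on (Field s) s"
    using wo(2) by (auto simp: order_on_defs)
  have sub: "underS s a \<subseteq> Field s"
    by (auto simp: underS_def intro: FieldI1)
  have F: "Field ?r = underS s a"
    using Refl_Field_Restr2[OF s(3) sub] .
  show ?thesis
  proof (rule seeker_wins_initial_segment[OF _ _ _ down])
    show "seeker_wins X P ?r"
      using seeker_wins_ordIso[OF a(2) assms(2)] .
    show "Field ?r \<subseteq> Field s"
      using F sub by simp
    show "underS s b = underS ?r b" if "b \<in> Field ?r" for b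
    proof -
      have b: "b \<in> underS s a" using that F by simp
      have "c \<in> underS s a" if "c \<in> underS s b" for c
        using b that transD[OF s(1), of c b a] antisymD[OF s(2), of c b] by (auto simp: underS_def)
      then show ?thesis
        using b by (auto simp: underS_def)
    qed
  qed
qed

section \<open>Backward induction over finitely many last moves\<close>

definition before_move :: "'a topology \<Rightarrow> 'a set set \<Rightarrow> 'a set set" where
  "before_move X P = {W. \<exists>U. openin X U \<and> W \<inter> U \<in> P \<and> W - U \<in> P}"

text \<open>At the last move only the current outcome counts. The Hider may answer either way, so
  both parts of the outcome must win; conversely the Seeker reads the outcome off the history and
  picks a suitable open set.\<close>

lemma seeker_wins_last_move:
  assumes F: "Field r' = insert t (Field r)" "t \<notin> Field r"
    and under: "\<And>a. a \<in> Field r \<Longrightarrow> underS r' a = underS r a" "underS r' t = Field r"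
  shows "seeker_wins X P r' \<longleftrightarrow> seeker_wins X (before_move X P) r"
proof
  assume "seeker_wins X P r'"
  then obtain \<sigma> where op: "\<forall>\<alpha>\<in>Field r'. \<forall>h. openin X (\<sigma> \<alpha> h)"
    and out: "\<forall>U V. consistent_play X r' \<sigma> U V \<longrightarrow> game_outcome X r' V \<in> P"
    unfolding seeker_wins_def by blast
  have "game_outcome X r V \<in> before_move X P" if play: "consistent_play X r \<sigma> U V" for U V
  proof -
    \<comment> \<open>The Seeker's last move is fixed before the answer, so the same
      \<open>u\<close> serves both choices of \<open>v\<close>.\<close>
    define u where "u = \<sigma> t (restrict (\<lambda>\<gamma>. (U \<gamma>, V \<gamma>)) (Field r))"
    have last: "game_outcome X r V \<inter> v \<in> P" if v: "v \<in> {u, topspace X - u}" for v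
    proof -
      have eq: "restrict (\<lambda>\<gamma>. ((U(t := u)) \<gamma>, (V(t := v)) \<gamma>)) A = restrict (\<lambda>\<gamma>. (U \<gamma>, V \<gamma>)) A"
        if "t \<notin> A" for A
        using that by (intro restrict_ext) auto
      have t: "t \<notin> underS r \<alpha>" for \<alpha>
        using F(2) by (auto simp: underS_def intro: FieldI1)
      have "consistent_play X r' \<sigma> (U(t := u)) (V(t := v))"
        unfolding consistent_play_def
      proof (intro ballI)
        fix \<alpha>
        assume "\<alpha> \<in> Field r'"
        then consider "\<alpha> = t" | "\<alpha> \<in> Field r" "\<alpha> \<noteq> t"
          using F by auto
        then show "(U(t := u)) \<alpha> = \<sigma> \<alpha> (restrict (\<lambda>\<gamma>. ((U(t := u)) \<gamma>, (V(t := v)) \<gamma>)) (underS r' \<alpha>)) \<and>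
          (V(t := v)) \<alpha> \<in> {(U(t := u)) \<alpha>, topspace X - (U(t := u)) \<alpha>}"
        proof cases
          case 1
          then show ?thesis
            using v unfolding 1 under(2) eq[OF F(2)] fun_upd_same u_def[symmetric] by blast
        next
          case 2
          then have "U \<alpha> = \<sigma> \<alpha> (restrict (\<lambda>\<gamma>. (U \<gamma>, V \<gamma>)) (underS r \<alpha>)) \<and>
              V \<alpha> \<in> {U \<alpha>, topspace X - U \<alpha>}"
            using play unfolding consistent_play_def by blast
          then show ?thesis
            unfolding under(1)[OF 2(1)] eq[OF t] fun_upd_other[OF 2(2)] .
        qed
      qed
      then have "game_outcome X r' (V(t := v)) \<in> P"
        using out by blast
      moreover have "game_outcome X r' (V(t := v)) = game_outcome X r V \<inter> v"
        using F unfolding game_outcome_def by auto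
      ultimately show ?thesis by simp
    qed
    have "game_outcome X r V \<inter> (topspace X - u) = game_outcome X r V - u"
      by (auto simp: game_outcome_def)
    then have "game_outcome X r V \<inter> u \<in> P" "game_outcome X r V - u \<in> P"
      using last[of u] last[of "topspace X - u"] by auto
    moreover have "openin X u"
      using op F(1) by (simp add: u_def)
    ultimately show ?thesis
      unfolding before_move_def by blast
  qed
  then show "seeker_wins X (before_move X P) r"
    using op F(1) unfolding seeker_wins_def by blast
next
  assume "seeker_wins X (before_move X P) r"
  then obtain \<sigma> where op: "\<forall>\<alpha>\<in>Field r. \<forall>h. openin X (\<sigma> \<alpha> h)"
    and out: "\<forall>U V. consistent_play X r \<sigma> U V \<longrightarrow> game_outcome X r V \<in> before_move X P"
    unfolding seeker_wins_def by blast
  define good where "good W U \<longleftrightarrow> openin X U \<and> W \<inter> U \<in> P \<and> W - U \<in> P" for W U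
  \<comment> \<open>The default \<open>{}\<close> keeps the move open at outcomes without a suitable
    set, since legality is demanded for every history.\<close>
  define pick where "pick W = (if Ex (good W) then Eps (good W) else {})" for W
  have good_pick: "good W (pick W)" if "Ex (good W)" for W
    using someI_ex[OF that] that by (simp add: pick_def)
  have pick_open: "openin X (pick W)" for W
  proof (cases "Ex (good W)")
    case True
    then show ?thesis
      using good_pick good_def by blast
  next
    case False
    then have "pick W = {}"
      unfolding pick_def by (rule if_not_P)
    then show ?thesis by simp
  qed
  have pick: "W \<inter> pick W \<in> P" "W - pick W \<in> P" if "W \<in> before_move X P" for W
  proof -
    have "Ex (good W)"
      using that unfolding before_move_def good_def by blast
    then show "W \<inter> pick W \<in> P" "W - pick W \<in> P"
      using good_pick good_def by blast+
  qed
  \<comment> \<open>At \<open>t\<close> the history covers all of \<open>Field r\<close>, so its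
    second components determine the current outcome.\<close>
  define \<sigma>' where "\<sigma>' \<alpha> h = (if \<alpha> = t then pick (game_outcome X r (\<lambda>\<gamma>. snd (h \<gamma>))) else \<sigma> \<alpha> h)" for \<alpha> h
  have "game_outcome X r' V \<in> P" if play: "consistent_play X r' \<sigma>' U V" for U V
  proof -
    have "consistent_play X r \<sigma> U V"
      unfolding consistent_play_def
    proof
      fix \<alpha>
      assume \<alpha>: "\<alpha> \<in> Field r"
      then have ne: "\<alpha> \<noteq> t"
        using F(2) by auto
      have "U \<alpha> = \<sigma>' \<alpha> (restrict (\<lambda>\<gamma>. (U \<gamma>, V \<gamma>)) (underS r' \<alpha>)) \<and>
          V \<alpha> \<in> {U \<alpha>, topspace X - U \<alpha>}"
        using play \<alpha> F(1) unfolding consistent_play_def by blast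
      then show "U \<alpha> = \<sigma> \<alpha> (restrict (\<lambda>\<gamma>. (U \<gamma>, V \<gamma>)) (underS r \<alpha>)) \<and>
          V \<alpha> \<in> {U \<alpha>, topspace X - U \<alpha>}"
        unfolding \<sigma>'_def if_not_P[OF ne] under(1)[OF \<alpha>] .
    qed
    then have W: "game_outcome X r V \<in> before_move X P"
      using out by blast
    have "game_outcome X r (\<lambda>\<gamma>. snd (restrict (\<lambda>\<gamma>. (U \<gamma>, V \<gamma>)) (underS r' t) \<gamma>)) = game_outcome X r V"
      unfolding game_outcome_def under(2) by auto
    then have "V t \<in> {pick (game_outcome X r V), topspace X - pick (game_outcome X r V)}"
      using play F(1) unfolding consistent_play_def by (auto simp: \<sigma>'_def)
    moreover have "game_outcome X r' V = game_outcome X r V \<inter> V t"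
      using F(1) by (auto simp: game_outcome_def)
    moreover have "game_outcome X r V \<inter> (topspace X - pick (game_outcome X r V)) =
        game_outcome X r V - pick (game_outcome X r V)"
      by (auto simp: game_outcome_def)
    ultimately show ?thesis
      using pick[OF W] by auto
  qed
  moreover have "\<forall>\<alpha>\<in>Field r'. \<forall>h. openin X (\<sigma>' \<alpha> h)"
    using op pick_open F(1) by (auto simp: \<sigma>'_def)
  ultimately show "seeker_wins X P r'"
    unfolding seeker_wins_def by blast
qed

text \<open>The induction peels off the last move, which changes the winning condition; hence
  \<open>P\<close> is kept arbitrary.\<close>

lemma seeker_wins_finitely_many_moves:
  assumes "Well_order r"
  shows "seeker_wins X P (ordinal_sum r (natLeq_on m)) \<longleftrightarrow> seeker_wins X ((before_move X ^^ m) P) r"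
proof (induction m arbitrary: P)
  case 0
  show ?case
    using seeker_wins_ordIso[OF ordinal_sum_empty_right[OF assms]]
      seeker_wins_ordIso[OF ordIso_symmetric[OF ordinal_sum_empty_right[OF assms]]] by auto
next
  case (Suc m)
  have "underS (ordinal_sum r (natLeq_on (Suc m))) a = underS (ordinal_sum r (natLeq_on m)) a"
    if "a \<in> Field (ordinal_sum r (natLeq_on m))" for a
  proof (cases a)
    case (Inl b)
    then show ?thesis by (simp add: underS_ordinal_sum_Inl)
  next
    case (Inr b)
    then have "b < m"
      using that by (auto simp: Field_natLeq_on)
    then have "underS (natLeq_on (Suc m)) b = underS (natLeq_on m) b"
      using underS_natLeq_on[of b] by simp
    then show ?thesis
      using \<open>b < m\<close> Inr by (simp add: underS_ordinal_sum_Inr Field_natLeq_on)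
  qed
  moreover have "underS (ordinal_sum r (natLeq_on (Suc m))) (Inr m) = Field (ordinal_sum r (natLeq_on m))"
    using underS_natLeq_on[of m "Suc m"]
    by (auto simp: underS_ordinal_sum_Inr Field_natLeq_on)
  moreover have "Field (ordinal_sum r (natLeq_on (Suc m))) = insert (Inr m) (Field (ordinal_sum r (natLeq_on m)))"
    unfolding Field_ordinal_sum Field_natLeq_on by auto
  moreover have "Inr m \<notin> Field (ordinal_sum r (natLeq_on m))"
    unfolding Field_ordinal_sum Field_natLeq_on by auto
  ultimately have "seeker_wins X P (ordinal_sum r (natLeq_on (Suc m))) \<longleftrightarrow>
      seeker_wins X (before_move X P) (ordinal_sum r (natLeq_on m))"
    by (intro seeker_wins_last_move)
  then show ?case
    using Suc.IH by (simp add: funpow_swap1)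
qed

text \<open>\<open>Q k L\<close> is the Hider's promise to survive \<open>k\<close> more moves from
  the outcome \<open>L\<close>; the index counts the remaining moves downwards.\<close>

lemma not_before_moves_if_invariant:
  assumes "Q m W"
    and "\<And>L. Q 0 L \<Longrightarrow> L \<notin> P"
    and step: "\<And>k L U. Q (Suc k) L \<Longrightarrow> openin X U \<Longrightarrow> Q k (L \<inter> U) \<or> Q k (L - U)"
  shows "W \<notin> (before_move X ^^ m) P"
  using assms(1)
proof (induction m arbitrary: W)
  case 0
  then show ?case using assms(2) by simp
next
  case (Suc m)
  then show ?case
    using step[OF Suc.prems] unfolding before_move_def by auto
qed

text \<open>The Hider stores a private state at each move, and \<open>Good\<close> relates a reply
  and its state to the earlier states \<open>D\<close>. An answer is demanded for every
  \<open>D\<close>, even one that no play produces, so the recursion carries no invariant; coherence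
  of the states is derived afterwards from \<open>Good\<close>.\<close>

lemma hider_play:
  fixes r :: "'b rel" and Good :: "'b \<Rightarrow> ('b \<Rightarrow> 'c) \<Rightarrow> 'a set \<Rightarrow> 'c \<Rightarrow> bool"
  assumes r: "Well_order r" and op: "\<forall>\<alpha>\<in>Field r. \<forall>h. openin X (\<sigma> \<alpha> h)"
    and answer: "\<And>\<alpha> D U. \<alpha> \<in> Field r \<Longrightarrow> openin X U \<Longrightarrow> \<exists>V c. V \<in> {U, topspace X - U} \<and> Good \<alpha> D V c"
  obtains U V S where "consistent_play X r \<sigma> U V"
    "\<forall>\<alpha>\<in>Field r. Good \<alpha> (restrict S (underS r \<alpha>)) (V \<alpha>) (S \<alpha>)"
proof -
  define reply where "reply \<alpha> D U =
    (SOME vc. fst vc \<in> {U, topspace X - U} \<and> Good \<alpha> D (fst vc) (snd vc))" for \<alpha> D U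
  have reply: "fst (reply \<alpha> D U) \<in> {U, topspace X - U} \<and>
      Good \<alpha> D (fst (reply \<alpha> D U)) (snd (reply \<alpha> D U))"
    if "\<alpha> \<in> Field r" "openin X U" for \<alpha> D U
  proof -
    have "\<exists>vc. fst vc \<in> {U, topspace X - U} \<and> Good \<alpha> D (fst vc) (snd vc)"
      using answer[OF that, of D] by auto
    then show ?thesis
      unfolding reply_def by (rule someI_ex)
  qed
  \<comment> \<open>Values of \<open>f\<close> are triples: the Seeker's set, the Hider's answer and
    the private state. Only the first two are shown to \<open>\<sigma>\<close>.\<close>
  define move where "move f \<alpha> = \<sigma> \<alpha> (restrict (\<lambda>\<gamma>. (fst (f \<gamma>), fst (snd (f \<gamma>)))) (underS r \<alpha>))"
    for f :: "'b \<Rightarrow> 'a set \<times> 'a set \<times> 'c" and \<alpha>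
  define H where "H f \<alpha> = (move f \<alpha>, reply \<alpha> (restrict (\<lambda>\<gamma>. snd (snd (f \<gamma>))) (underS r \<alpha>)) (move f \<alpha>))"
    for f :: "'b \<Rightarrow> 'a set \<times> 'a set \<times> 'c" and \<alpha>
  define f where "f = wfrec (r - Id) H"
  have wf: "wf (r - Id)"
    using r by (simp add: well_order_on_def)
  have f: "f \<alpha> = H f \<alpha>" for \<alpha>
  proof -
    have "f \<alpha> = H (cut f (r - Id) \<alpha>) \<alpha>"
      unfolding f_def by (rule wfrec[OF wf])
    moreover have "cut f (r - Id) \<alpha> \<gamma> = f \<gamma>" if "\<gamma> \<in> underS r \<alpha>" for \<gamma>
      using that by (simp add: cut_def underS_def)
    then have "H (cut f (r - Id) \<alpha>) \<alpha> = H f \<alpha>"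
      unfolding H_def move_def by (simp cong: restrict_cong)
    ultimately show ?thesis by simp
  qed
  define U where "U \<alpha> = fst (f \<alpha>)" for \<alpha>
  define V where "V \<alpha> = fst (snd (f \<alpha>))" for \<alpha>
  define S where "S \<alpha> = snd (snd (f \<alpha>))" for \<alpha>
  have U: "U \<alpha> = \<sigma> \<alpha> (restrict (\<lambda>\<gamma>. (U \<gamma>, V \<gamma>)) (underS r \<alpha>))" for \<alpha>
    unfolding U_def V_def by (subst f) (simp add: H_def move_def)
  have VS: "(V \<alpha>, S \<alpha>) = reply \<alpha> (restrict S (underS r \<alpha>)) (U \<alpha>)" for \<alpha>
    unfolding U_def V_def S_def by (subst (1 2 4) f) (simp add: H_def)
  have *: "V \<alpha> \<in> {U \<alpha>, topspace X - U \<alpha>} \<and> Good \<alpha> (restrict S (underS r \<alpha>)) (V \<alpha>) (S \<alpha>)"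
    if "\<alpha> \<in> Field r" for \<alpha>
  proof -
    have "openin X (U \<alpha>)"
      using op that U by metis
    from reply[OF that this, of "restrict S (underS r \<alpha>)"] show ?thesis
      unfolding VS[symmetric] by simp
  qed
  show thesis
  proof (rule that[of U V S])
    show "consistent_play X r \<sigma> U V"
      unfolding consistent_play_def using U * by blast
    show "\<forall>\<alpha>\<in>Field r. Good \<alpha> (restrict S (underS r \<alpha>)) (V \<alpha>) (S \<alpha>)"
      using * by blast
  qed
qed

section \<open>The Seeker\<close>

lemma separating_sets_subset: "W \<in> separating_sets \<Longrightarrow> W' \<subseteq> W \<Longrightarrow> W' \<in> separating_sets"
  using card_mono[of W W'] finite_subset[of W' W] by (auto simp: separating_sets_def)

lemma deciding_sets_subset: "W \<in> deciding_sets Y \<Longrightarrow> W' \<subseteq> W \<Longrightarrow> W' \<in> deciding_sets Y"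
  unfolding deciding_sets_def by blast

section \<open>Bisection strategies\<close>

lemma ex_rat_between:
  fixes s t :: real
  assumes "s < t"
  obtains q :: rat where "s < of_rat q" "of_rat q < t"
  using of_rat_dense[OF assms] by blast

definition resolved_sets ::
  "'i set \<Rightarrow> 'b rel \<Rightarrow> ('b \<Rightarrow> 'i \<times> rat option) \<Rightarrow> ('i \<Rightarrow> double_arrow) set set" where
  "resolved_sets I r e = {W. W \<subseteq> topspace (double_arrow_power I) \<and>
    (\<forall>i. \<forall>x\<in>W. \<forall>y\<in>W.
      ((\<forall>q. \<exists>a\<in>Field r. e a = (i, Some q)) \<longrightarrow> pos (x i) = pos (y i)) \<and>
      ((\<exists>a\<in>Field r. e a = (i, None) \<and> (\<forall>q. \<exists>b\<in>underS r a. e b = (i, Some q))) \<longrightarrow> x i = y i))}"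

text \<open>
  A move labelled \<open>(i, Some q)\<close> bisects the \<open>i\<close>-th coordinate at \<open>q\<close>. Once all
  rationals have been played, only the two points with one real part are left for this coordinate,
  and a move labelled \<open>(i, None)\<close> separates them.
\<close>

lemma seeker_wins_labelled:
  fixes r :: "'b rel" and e :: "'b \<Rightarrow> 'i \<times> rat option"
  assumes e: "\<And>a. a \<in> Field r \<Longrightarrow> fst (e a) \<in> I"
  shows "seeker_wins (double_arrow_power I) (resolved_sets I r e) r"
proof -
  let ?X = "double_arrow_power I"
  \<comment> \<open>This open ray contains the lower point over \<open>t\<close> and omits the upper
    one, so it serves both to bisect and to split. For \<open>t\<close> outside [0,1] the point
    \<open>arrow t 1\<close> is unspecified, but the set is still open and thus a legal
    move.\<close>
  define cut where "cut i t = {y \<in> topspace ?X. y i \<in> {..<arrow t 1}}" for i t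
  have cut_open: "openin ?X (cut i t)" if "i \<in> I" for i t
    unfolding cut_def by (rule openin_coordinate[OF that open_lessThan])
  define W where "W r' h = topspace ?X \<inter> (\<Inter>\<gamma>\<in>r'. snd (h \<gamma>))"
    for r' and h :: "'b \<Rightarrow> ('i \<Rightarrow> double_arrow) set \<times> ('i \<Rightarrow> double_arrow) set"
  \<comment> \<open>A splitting move cuts at the real part of an arbitrary point of the current
    outcome. If the outcome is nonempty and all rational cuts for \<open>i\<close> have been made,
    every choice gives the same real number.\<close>
  define \<sigma> where "\<sigma> \<alpha> h = (case e \<alpha> of
      (i, Some q) \<Rightarrow> cut i (of_rat q)
    | (i, None) \<Rightarrow> cut i (pos ((SOME x. x \<in> W (underS r \<alpha>) h) i)))" for \<alpha> h
  have \<sigma>_open: "openin ?X (\<sigma> \<alpha> h)" if "\<alpha> \<in> Field r" for \<alpha> h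
    using e[OF that] cut_open unfolding \<sigma>_def by (cases "e \<alpha>") (auto split: option.split)
  have main: "((\<forall>q. \<exists>a\<in>Field r. e a = (i, Some q)) \<longrightarrow> pos (x i) = pos (y i)) \<and>
      ((\<exists>a\<in>Field r. e a = (i, None) \<and> (\<forall>q. \<exists>b\<in>underS r a. e b = (i, Some q))) \<longrightarrow> x i = y i)"
    if play: "consistent_play ?X r \<sigma> U V" and xy: "x \<in> game_outcome ?X r V" "y \<in> game_outcome ?X r V"
    for U V x y i
  proof -
    have V: "V \<alpha> \<in> {\<sigma> \<alpha> (restrict (\<lambda>\<gamma>. (U \<gamma>, V \<gamma>)) (underS r \<alpha>)),
        topspace ?X - \<sigma> \<alpha> (restrict (\<lambda>\<gamma>. (U \<gamma>, V \<gamma>)) (underS r \<alpha>))}" if "\<alpha> \<in> Field r" for \<alpha>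
    proof -
      have UV: "U \<alpha> = \<sigma> \<alpha> (restrict (\<lambda>\<gamma>. (U \<gamma>, V \<gamma>)) (underS r \<alpha>))"
          "V \<alpha> \<in> {U \<alpha>, topspace ?X - U \<alpha>}"
        using play that unfolding consistent_play_def by blast+
      show ?thesis
        using UV(2) unfolding UV(1) .
    qed
    \<comment> \<open>Stated for a set \<open>B\<close> of moves, as it is applied both to the whole
      play and to the moves before a splitting move.\<close>
    have not_less: "\<not> pos (x i) < pos (y i)"
      if xy: "x \<in> topspace ?X" "y \<in> topspace ?X" and B: "B \<subseteq> Field r"
        and cuts: "\<And>q. \<exists>b\<in>B. e b = (i, Some q)" and xB: "\<And>b. b \<in> B \<Longrightarrow> x \<in> V b \<and> y \<in> V b" for x y B
    proof
      assume "pos (x i) < pos (y i)"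
      then obtain q where q: "pos (x i) < of_rat q" "of_rat q < pos (y i)"
        by (rule ex_rat_between)
      then have bounds: "0 \<le> real_of_rat q" "real_of_rat q \<le> 1"
        using pos_bounds(1)[of "x i"] pos_bounds(2)[of "y i"] by linarith+
      obtain b where b: "b \<in> B" "e b = (i, Some q)"
        using cuts by blast
      then have "V b \<in> {cut i (of_rat q), topspace ?X - cut i (of_rat q)}"
        using V[of b] B by (auto simp: \<sigma>_def)
      moreover have "x \<in> cut i (of_rat q)"
        using xy(1) less_arrow_if_pos_less[OF q(1) bounds(2), of 1] by (simp add: cut_def)
      moreover have "y \<notin> cut i (of_rat q)"
        using arrow_less_if_less_pos[OF q(2) bounds(1), of 1] by (auto simp: cut_def)
      ultimately show False
        using xB[OF b(1)] by auto
    qed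
    have pos_eq: "pos (x i) = pos (y i)"
      if xy: "x \<in> topspace ?X" "y \<in> topspace ?X" and B: "B \<subseteq> Field r"
        and cuts: "\<And>q. \<exists>b\<in>B. e b = (i, Some q)" and xB: "\<And>b. b \<in> B \<Longrightarrow> x \<in> V b \<and> y \<in> V b" for x y B
      using not_less[OF xy B cuts] not_less[OF xy(2,1) B cuts] xB by fastforce
    have xyX: "x \<in> topspace ?X" "y \<in> topspace ?X"
      and xyV: "\<And>b. b \<in> Field r \<Longrightarrow> x \<in> V b \<and> y \<in> V b"
      using xy by (auto simp: game_outcome_def)
    have "x i = y i"
      if a: "a \<in> Field r" "e a = (i, None)" and q: "\<And>q. \<exists>b\<in>underS r a. e b = (i, Some q)" for a
    proof -
      let ?h = "restrict (\<lambda>\<gamma>. (U \<gamma>, V \<gamma>)) (underS r a)"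
      have B: "underS r a \<subseteq> Field r"
        by (auto simp: underS_def intro: FieldI1)
      have Weq: "W (underS r a) ?h = topspace ?X \<inter> (\<Inter>\<gamma>\<in>underS r a. V \<gamma>)"
        by (simp add: W_def)
      define z where "z = (SOME x. x \<in> W (underS r a) ?h)"
      have "x \<in> W (underS r a) ?h"
        unfolding Weq using xyX xyV B by blast
      then have z: "z \<in> topspace ?X \<inter> (\<Inter>\<gamma>\<in>underS r a. V \<gamma>)"
        unfolding z_def Weq[symmetric] by (rule someI[of "\<lambda>x. x \<in> W (underS r a) ?h"])
      have xz: "pos (x i) = pos (z i)"
        using pos_eq[OF xyX(1) _ B q] z xyV B by blast
      have yz: "pos (y i) = pos (z i)"
        using pos_eq[OF xyX(2) _ B q] z xyV B by blast
      have "V a \<in> {cut i (pos (z i)), topspace ?X - cut i (pos (z i))}"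
        using V[OF a(1)] a(2) by (simp add: \<sigma>_def z_def)
      then have "x \<in> cut i (pos (z i)) \<longleftrightarrow> y \<in> cut i (pos (z i))"
        using xyV[OF a(1)] by blast
      then have iff: "x i < arrow (pos (z i)) 1 \<longleftrightarrow> y i < arrow (pos (z i)) 1"
        using xyX by (simp add: cut_def)
      have zb: "pos (z i) \<in> {0..1}"
        using pos_bounds by simp
      have form: "p = arrow (pos (z i)) 0 \<or> p = arrow (pos (z i)) 1" if "pos p = pos (z i)" for p
        using that by (cases p rule: arrow_cases) auto
      show ?thesis
        using form[OF xz] form[OF yz] iff zb by auto
    qed
    then show ?thesis
      using pos_eq[OF xyX, of "Field r"] xyV by blast
  qed
  show ?thesis
    unfolding seeker_wins_def
  proof (intro exI[of _ \<sigma>] conjI ballI allI impI)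
    show "openin ?X (\<sigma> \<alpha> h)" if "\<alpha> \<in> Field r" for \<alpha> h
      using \<sigma>_open[OF that] .
    fix U V
    assume play: "consistent_play ?X r \<sigma> U V"
    have "game_outcome ?X r V \<subseteq> topspace ?X"
      by (simp add: game_outcome_def)
    then show "game_outcome ?X r V \<in> resolved_sets I r e"
      unfolding resolved_sets_def mem_Collect_eq
      by (rule conjI) (intro allI ballI, rule main[OF play])
  qed
qed

lemma seeker_wins_separating_labelled:
  fixes r :: "'b rel" and e :: "'b \<Rightarrow> 'i \<times> rat option"
  assumes "\<And>a. a \<in> Field r \<Longrightarrow> fst (e a) \<in> I"
    and "\<And>i. i \<in> I \<Longrightarrow> \<exists>a\<in>Field r. e a = (i, None) \<and> (\<forall>q. \<exists>b\<in>underS r a. e b = (i, Some q))"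
  shows "seeker_wins (double_arrow_power I) separating_sets r"
proof (rule seeker_wins_mono[OF seeker_wins_labelled[OF assms(1)]])
  show "(resolved_sets I r e)
    \<subseteq> separating_sets"
  proof
    fix W
    assume "W \<in> resolved_sets I r e"
    then have W: "W \<subseteq> I \<rightarrow>\<^sub>E UNIV"
      and eq: "\<And>i x y. i \<in> I \<Longrightarrow> x \<in> W \<Longrightarrow> y \<in> W \<Longrightarrow> x i = y i"
      using assms(2) unfolding resolved_sets_def topspace_double_arrow_power by blast+
    have "x = y" if xy: "x \<in> W" "y \<in> W" for x y
    proof (rule PiE_ext)
      show "x \<in> I \<rightarrow>\<^sub>E UNIV" "y \<in> I \<rightarrow>\<^sub>E UNIV"
        using W xy by auto
      show "x i = y i" if "i \<in> I" for i
        using eq[OF that xy] .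
    qed
    then have "W = {} \<or> (\<exists>x. W = {x})"
      by blast
    then show "W \<in> separating_sets"
      by (auto simp: separating_sets_def)
  qed
qed

section \<open>Countable index sets\<close>

lemma countable_labels:
  assumes "countable I" "I \<noteq> {}"
  obtains e :: "nat \<Rightarrow> 'i \<times> rat" where "range e = I \<times> UNIV"
proof -
  have "countable (I \<times> (UNIV :: rat set))"
    using assms(1) by simp
  moreover have "I \<times> (UNIV :: rat set) \<noteq> {}"
    using assms(2) by simp
  ultimately have "range (from_nat_into (I \<times> (UNIV :: rat set))) = I \<times> UNIV"
    by (intro range_from_nat_into)
  then show thesis
    by (rule that)
qed

lemma seeker_wins_separating_countable:
  assumes I: "countable I" "I \<noteq> {}"
  shows "seeker_wins (double_arrow_power I) separating_sets (ordinal_sum natLeq |I| )"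
proof -
  obtain e :: "nat \<Rightarrow> 'a \<times> rat" where e: "range e = I \<times> UNIV"
    using countable_labels[OF I] .
  \<comment> \<open>All bisections lie in the first summand and all splitting moves in the second,
    so each splitting move comes after every rational cut, whichever well-order \<open>|I|\<close>
    is.\<close>
  define e' where "e' a = (case a of Inl n \<Rightarrow> (fst (e n), Some (snd (e n))) | Inr i \<Rightarrow> (i, None))" for a
  show ?thesis
  proof (rule seeker_wins_separating_labelled[of _ e'])
    show "fst (e' a) \<in> I" if "a \<in> Field (ordinal_sum natLeq |I| )" for a
    proof (cases a)
      case (Inl n)
      have "e n \<in> I \<times> UNIV"
        using e by blast
      then show ?thesis
        using Inl by (auto simp: e'_def)
    next
      case (Inr i)
      then show ?thesis
        using that by (auto simp: e'_def Field_card_of)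
    qed
    fix i
    assume i: "i \<in> I"
    have "\<exists>b\<in>underS (ordinal_sum natLeq |I| ) (Inr i). e' b = (i, Some q)" for q
    proof -
      have "(i, q) \<in> range e"
        using e i by auto
      then obtain n where "(i, q) = e n"
        by blast
      then have "e' (Inl n) = (i, Some q)"
        by (simp add: e'_def flip: \<open>(i, q) = e n\<close>)
      then show ?thesis
        using i by (intro bexI[of _ "Inl n"]) (auto simp: underS_ordinal_sum_Inr Field_card_of Field_natLeq)
    qed
    then show "\<exists>a\<in>Field (ordinal_sum natLeq |I| ). e' a = (i, None) \<and>
        (\<forall>q. \<exists>b\<in>underS (ordinal_sum natLeq |I| ) a. e' b = (i, Some q))"
      using i by (intro bexI[of _ "Inr i"]) (auto simp: e'_def Field_card_of)
  qed
qed

text \<open>Stops before any splitting move: for finite \<open>I\<close> a single final move will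
  then deal with all coordinates together.\<close>

lemma seeker_wins_positions_countable:
  assumes I: "countable I" "I \<noteq> {}"
  shows "seeker_wins (double_arrow_power I)
    {W. W \<subseteq> topspace (double_arrow_power I) \<and> (\<forall>i\<in>I. \<forall>x\<in>W. \<forall>y\<in>W. pos (x i) = pos (y i))} natLeq"
proof -
  obtain e :: "nat \<Rightarrow> 'a \<times> rat" where e: "range e = I \<times> UNIV"
    using countable_labels[OF I] .
  define e' where "e' n = (fst (e n), Some (snd (e n)))" for n
  have fst_e': "fst (e' n) \<in> I" for n
  proof -
    have "e n \<in> I \<times> UNIV"
      using e by blast
    then show ?thesis
      by (auto simp: e'_def)
  qed
  have labels: "\<exists>n\<in>Field natLeq. e' n = (i, Some q)" if "i \<in> I" for i q
  proof -
    have "(i, q) \<in> range e"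
      using e that by auto
    then obtain n where "(i, q) = e n"
      by blast
    then have "e' n = (i, Some q)"
      by (simp add: e'_def flip: \<open>(i, q) = e n\<close>)
    then show ?thesis
      by (auto simp: Field_natLeq)
  qed
  show ?thesis
  proof (rule seeker_wins_mono[OF seeker_wins_labelled])
    show "fst (e' n) \<in> I" for n
      by (rule fst_e')
    show "resolved_sets I natLeq e' \<subseteq> {W. W \<subseteq> topspace (double_arrow_power I) \<and>
        (\<forall>i\<in>I. \<forall>x\<in>W. \<forall>y\<in>W. pos (x i) = pos (y i))}"
    proof (intro subsetI CollectI conjI ballI)
      fix W
      assume W: "W \<in> resolved_sets I natLeq e'"
      show "x \<in> topspace (double_arrow_power I)" if "x \<in> W" for x
        using W that unfolding resolved_sets_def by blast
      show "pos (x i) = pos (y i)" if "i \<in> I" "x \<in> W" "y \<in> W" for i x y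
      proof -
        have "(\<forall>q. \<exists>a\<in>Field natLeq. e' a = (i, Some q)) \<longrightarrow> pos (x i) = pos (y i)"
          using W that(2,3) unfolding resolved_sets_def by blast
        then show ?thesis
          using labels[OF that(1)] by blast
      qed
    qed
  qed
qed

text \<open>The remaining set \<open>W\<close> lies in a product of finitely many two-point sets.
  Hence \<open>W - Y\<close> is finite, so closed in this Hausdorff space, and its complement is the
  last move, whatever \<open>Y\<close> is.\<close>

lemma seeker_wins_deciding_finite:
  assumes I: "finite I" "I \<noteq> {}"
  shows "seeker_wins (double_arrow_power I) (deciding_sets Y) (ordinal_sum natLeq (natLeq_on 1))"
proof -
  let ?X = "double_arrow_power I"
  have "W \<in> before_move ?X (deciding_sets Y)"
    if W: "W \<subseteq> topspace ?X" and eq: "\<And>i x y. i \<in> I \<Longrightarrow> x \<in> W \<Longrightarrow> y \<in> W \<Longrightarrow> pos (x i) = pos (y i)" for W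
  proof -
    have "finite W"
    proof (cases "W = {}")
      case False
      then obtain x where x: "x \<in> W" by blast
      have form: "p = arrow t 0 \<or> p = arrow t 1" if "pos p = t" for p t
        using that by (cases p rule: arrow_cases) auto
      have "W \<subseteq> (\<Pi>\<^sub>E i\<in>I. {arrow (pos (x i)) 0, arrow (pos (x i)) 1})"
      proof
        fix y
        assume y: "y \<in> W"
        have "y i \<in> {arrow (pos (x i)) 0, arrow (pos (x i)) 1}" if "i \<in> I" for i
          using form[OF eq[OF that y x]] by simp
        moreover have "y \<in> I \<rightarrow>\<^sub>E UNIV"
          using W y by auto
        ultimately show "y \<in> (\<Pi>\<^sub>E i\<in>I. {arrow (pos (x i)) 0, arrow (pos (x i)) 1})"
          by (simp add: PiE_iff)
      qed
      then show ?thesis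
        by (rule finite_subset) (simp add: finite_PiE I)
    qed simp
    then have "closedin ?X (W - Y)"
      using W by (intro closedin_Hausdorff_finite Hausdorff_double_arrow_power) auto
    then have "openin ?X (topspace ?X - (W - Y))"
      by blast
    moreover have "W \<inter> (topspace ?X - (W - Y)) \<subseteq> Y" "(W - (topspace ?X - (W - Y))) \<inter> Y = {}"
      using W by blast+
    ultimately show ?thesis
      unfolding before_move_def deciding_sets_def by blast
  qed
  then have "{W. W \<subseteq> topspace ?X \<and> (\<forall>i\<in>I. \<forall>x\<in>W. \<forall>y\<in>W. pos (x i) = pos (y i))}
      \<subseteq> before_move ?X (deciding_sets Y)"
    by blast
  then have "seeker_wins ?X (before_move ?X (deciding_sets Y)) natLeq"
    using seeker_wins_mono[OF seeker_wins_positions_countable[OF countable_finite[OF I(1)] I(2)]] by blast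
  then show ?thesis
    using seeker_wins_finitely_many_moves[OF natLeq_Well_order, of ?X "deciding_sets Y" 1] by simp
qed

section \<open>Uncountable index sets\<close>

lemma card_of_Times_countable_ordLess:
  assumes A: "|A| <o |I|" and B: "|B| \<le>o natLeq" and I: "natLeq <o |I|"
  shows "|A \<times> B| <o |I|"
proof (cases "|A| \<le>o natLeq")
  case True
  have "|A \<times> B| \<le>o natLeq"
    by (rule card_of_Times_ordLeq_infinite_Field[OF _ True B natLeq_Card_order]) (simp add: Field_natLeq)
  then show ?thesis
    using I by (rule ordLeq_ordLess_trans)
next
  case False
  then have less: "natLeq <o |A|"
    using not_ordLeq_iff_ordLess[OF natLeq_Well_order card_of_Well_order] by blast
  then have "infinite (Field |A| )"
    using infinite_iff_natLeq_ordLeq[of A] ordLess_imp_ordLeq by (simp add: Field_card_of)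
  then have "|A \<times> B| \<le>o |A|"
    using card_of_Times_ordLeq_infinite_Field[of "|A|" A B] ordLeq_transitive[OF B ordLess_imp_ordLeq[OF less]]
      ordLeq_reflexive[OF card_of_Well_order] card_of_Card_order by blast
  then show ?thesis
    using A by (rule ordLeq_ordLess_trans)
qed

text \<open>As \<open>|I|\<close> is an initial ordinal, it is enough that every proper initial
  segment of the product has smaller cardinality. Such a segment meets fewer than \<open>|I|\<close>
  blocks, and each block is countable.\<close>

lemma lexicographic_ordLeq_card_of:
  assumes I: "natLeq <o |I|" and s: "Well_order s" "countable (Field s)"
  shows "lexicographic |I| s \<le>o |I|"
proof -
  note L = Well_order_lexicographic[OF card_of_Well_order s(1), of I]
  let ?L = "lexicographic |I| s"
  have "infinite I"
    using I infinite_iff_natLeq_ordLeq[of I] ordLess_imp_ordLeq by blast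
  have sI: "|Field s| \<le>o natLeq"
  proof -
    have "|Field s| \<le>o |UNIV :: nat set|"
      using s(2) unfolding countable_def card_of_ordLeq[symmetric] by blast
    then show ?thesis
      using card_of_nat by (rule ordLeq_ordIso_trans)
  qed
  have "Restr ?L (underS ?L p) <o |I|" if p: "p \<in> Field ?L" for p
  proof -
    obtain i k where ik: "p = (i, k)" "i \<in> I"
      using p by (auto simp: Field_lexicographic[OF s(1)] Field_card_of)
    \<comment> \<open>The segment may end inside block \<open>i\<close>, which is therefore added to
      the earlier blocks.\<close>
    have "underS ?L p \<subseteq> insert i (underS |I| i) \<times> Field s"
      unfolding ik underS_def lexicographic_def by auto
    then have "|underS ?L p| \<le>o |insert i (underS |I| i) \<times> Field s|"
      by (rule card_of_mono1)
    moreover have "|insert i (underS |I| i)| <o |I|"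
    proof -
      have "|underS |I| i| <o |I|"
        using card_of_underS[OF card_of_Card_order, of i I] ik(2) by (simp add: Field_card_of)
      moreover have "|{i}| <o |I|"
        using \<open>infinite I\<close>
        by (intro finite_ordLess_infinite card_of_Well_order) (simp_all add: Field_card_of)
      ultimately have "|{i} \<union> underS |I| i| <o |I|"
        using card_of_Un_ordLess_infinite[OF \<open>infinite I\<close>] by blast
      then show ?thesis by simp
    qed
    ultimately have *: "|underS ?L p| <o |I|"
      using card_of_Times_countable_ordLess[OF _ sI I] ordLeq_ordLess_trans by blast
    have W: "Well_order (Restr ?L (underS ?L p))"
      by (rule Well_order_Restr[OF L])
    show ?thesis
    proof (rule ccontr)
      assume "\<not> ?thesis"
      then have "|I| \<le>o Restr ?L (underS ?L p)"
        using not_ordLess_iff_ordLeq[OF card_of_Well_order W] by blast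
      then have "|Field |I| | \<le>o |Field (Restr ?L (underS ?L p))|"
        by (rule card_of_mono2)
      also have "|Field (Restr ?L (underS ?L p))| \<le>o |underS ?L p|"
        by (rule card_of_mono1[OF Field_Restr_subset])
      finally have "|I| \<le>o |underS ?L p|"
        by (simp add: Field_card_of)
      with * show False
        using not_ordLess_ordLeq by blast
    qed
  qed
  then show ?thesis
    using ordLeq_iff_ordLess_Restr[OF L card_of_Well_order] by blast
qed

lemma seeker_wins_separating_uncountable:
  assumes I: "natLeq <o |I|"
  shows "seeker_wins (double_arrow_power I) separating_sets |I|"
proof -
  let ?s = "ordinal_sum natLeq (natLeq_on 1)"
  let ?L = "lexicographic |I| ?s"
  have s: "Well_order ?s"
    by (rule Well_order_ordinal_sum[OF natLeq_Well_order natLeq_on_Well_order])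
  have Fs: "Field ?s = range Inl \<union> {Inr 0}"
    unfolding Field_ordinal_sum Field_natLeq Field_natLeq_on by auto
  have Inl_Inr: "(Inl n, Inr 0) \<in> ?s" for n
    unfolding ordinal_sum_iff Field_natLeq Field_natLeq_on by simp
  note FL = Field_lexicographic[OF s, of "|I|", unfolded Fs Field_card_of]
  define q :: "nat \<Rightarrow> rat" where "q = from_nat_into UNIV"
  have q: "range q = UNIV"
    unfolding q_def by (rule range_from_nat_into) auto
  define e :: "'a \<times> (nat + nat) \<Rightarrow> 'a \<times> rat option"
    where "e = (\<lambda>(i, k). (i, case k of Inl n \<Rightarrow> Some (q n) | Inr _ \<Rightarrow> None))"
  have win: "seeker_wins (double_arrow_power I) separating_sets ?L"
  proof (rule seeker_wins_separating_labelled[of _ e])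
    show "fst (e a) \<in> I" if "a \<in> Field ?L" for a
      using that unfolding FL by (auto simp: e_def)
    fix i
    assume i: "i \<in> I"
    have "\<exists>b\<in>underS ?L (i, Inr 0). e b = (i, Some p)" for p
    proof -
      obtain n where "p = q n"
        using q by (metis UNIV_I imageE)
      moreover have "(i, Inl n) \<in> underS ?L (i, Inr 0)"
        using i Inl_Inr unfolding underS_def lexicographic_def Fs Field_card_of by auto
      ultimately show ?thesis
        by (intro bexI[of _ "(i, Inl n)"]) (simp_all add: e_def)
    qed
    moreover have "(i, Inr 0) \<in> Field ?L"
      using i unfolding FL by simp
    moreover have "e (i, Inr 0) = (i, None)"
      by (simp add: e_def)
    ultimately show "\<exists>a\<in>Field ?L. e a = (i, None) \<and> (\<forall>p. \<exists>b\<in>underS ?L a. e b = (i, Some p))"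
      by blast
  qed
  have "?L \<le>o |I|"
    by (rule lexicographic_ordLeq_card_of[OF I s]) (simp add: Fs)
  \<comment> \<open>Only an inequality of lengths is available, so the game along \<open>?L\<close>
    is padded to length \<open>|I|\<close>.\<close>
  from this win show ?thesis
    by (rule seeker_wins_longer) (rule separating_sets_subset)
qed

section \<open>The Hider\<close>

text \<open>\<open>N i\<close> is an open neighbourhood for every \<open>i \<in> I\<close>, not only
  for the finitely many restricted coordinates in \<open>F\<close>, so that the Hider can shrink all
  coordinates in the same way.\<close>

lemma basic_neighbourhood:
  assumes U: "openin (double_arrow_power I) U" "x \<in> U"
  obtains F N where "finite F" "F \<subseteq> I" "\<forall>i\<in>I. open (N i) \<and> x i \<in> N i"
    "{y \<in> topspace (double_arrow_power I). \<forall>i\<in>F. y i \<in> N i} \<subseteq> U"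
proof -
  obtain N where N: "finite {i \<in> I. N i \<noteq> topspace (euclidean :: double_arrow topology)}"
      "\<forall>i\<in>I. openin euclidean (N i)" "x \<in> Pi\<^sub>E I N" "Pi\<^sub>E I N \<subseteq> U"
    using U unfolding openin_product_topology_alt by blast
  let ?F = "{i \<in> I. N i \<noteq> UNIV}"
  show thesis
  proof (rule that[of ?F N])
    show "finite ?F" "?F \<subseteq> I"
      using N(1) by auto
    show "\<forall>i\<in>I. open (N i) \<and> x i \<in> N i"
      using N(2,3) by (auto simp: PiE_iff)
    have "y \<in> Pi\<^sub>E I N" if "y \<in> topspace (double_arrow_power I)" "\<forall>i\<in>?F. y i \<in> N i" for y
    proof (rule PiE_I)
      show "y i \<in> N i" if "i \<in> I" for i
        using \<open>\<forall>i\<in>?F. y i \<in> N i\<close> that by (cases "N i = UNIV") auto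
      show "y i = undefined" if "i \<notin> I" for i
        using \<open>y \<in> topspace _\<close> that by (auto simp: PiE_iff extensional_def)
    qed
    then show "{y \<in> topspace (double_arrow_power I). \<forall>i\<in>?F. y i \<in> N i} \<subseteq> U"
      using N(4) by blast
  qed
qed

lemma cylinder_in_open:
  assumes U: "openin (double_arrow_power I) U" "x \<in> U"
  obtains F where "finite F" "F \<subseteq> I" "{y \<in> topspace (double_arrow_power I). \<forall>i\<in>F. y i = x i} \<subseteq> U"
proof -
  obtain F N where F: "finite F" "F \<subseteq> I" and N: "\<forall>i\<in>I. open (N i) \<and> x i \<in> N i"
    and sub: "{y \<in> topspace (double_arrow_power I). \<forall>i\<in>F. y i \<in> N i} \<subseteq> U"
    by (rule basic_neighbourhood[OF U])
  have "y i \<in> N i" if "i \<in> F" "y i = x i" for y i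
    using N F(2) that by auto
  then have "{y \<in> topspace (double_arrow_power I). \<forall>i\<in>F. y i = x i} \<subseteq> U"
    using sub by blast
  then show thesis
    using that F by blast
qed

section \<open>Fibres and shrinking boxes\<close>

definition fibre :: "'i set \<Rightarrow> ('i \<Rightarrow> real) \<Rightarrow> ('i \<Rightarrow> double_arrow) set" where
  "fibre I t = {y \<in> topspace (double_arrow_power I). \<forall>i\<in>I. pos (y i) = t i}"

lemma fibre_eq_PiE:
  assumes "\<And>i. i \<in> I \<Longrightarrow> t i \<in> {0..1}"
  shows "fibre I t = (\<Pi>\<^sub>E i\<in>I. {arrow (t i) 0, arrow (t i) 1})"
proof -
  have iff: "pos p = t i \<longleftrightarrow> p \<in> {arrow (t i) 0, arrow (t i) 1}" if "i \<in> I" for p i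
    using assms[OF that] by (cases p rule: arrow_cases) auto
  show ?thesis
    unfolding fibre_def topspace_double_arrow_power by (auto simp: PiE_iff iff extensional_def)
qed

text \<open>\<open>fst c\<close> and \<open>snd c\<close> give the left and right ends. The upper
  point is taken on the left and the lower point on the right, which makes each proper interval
  clopen, with both points over every real strictly between its ends.\<close>

definition arrow_box :: "'i set \<Rightarrow> ('i \<Rightarrow> real) \<times> ('i \<Rightarrow> real) \<Rightarrow> ('i \<Rightarrow> double_arrow) set" where
  "arrow_box I c = {y \<in> topspace (double_arrow_power I). \<forall>i\<in>I. y i \<in> {arrow (fst c i) 1..arrow (snd c i) 0}}"

definition proper_box :: "'i set \<Rightarrow> ('i \<Rightarrow> real) \<times> ('i \<Rightarrow> real) \<Rightarrow> bool" where
  "proper_box I c \<longleftrightarrow> (\<forall>i\<in>I. 0 \<le> fst c i \<and> fst c i < snd c i \<and> snd c i \<le> 1)"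

definition inside_box ::
  "'i set \<Rightarrow> ('i \<Rightarrow> real) \<times> ('i \<Rightarrow> real) \<Rightarrow> ('i \<Rightarrow> real) \<times> ('i \<Rightarrow> real) \<Rightarrow> bool" where
  "inside_box I c c' \<longleftrightarrow> (\<forall>i\<in>I. fst c i < fst c' i \<and> fst c' i < snd c' i \<and> snd c' i < snd c i)"

lemma proper_box_inside:
  assumes "proper_box I c" "inside_box I c c'"
  shows "proper_box I c'"
  unfolding proper_box_def
proof
  fix i
  assume "i \<in> I"
  then have "0 \<le> fst c i" "fst c i < fst c' i" "fst c' i < snd c' i" "snd c' i < snd c i" "snd c i \<le> 1"
    using assms unfolding proper_box_def inside_box_def by blast+
  then show "0 \<le> fst c' i \<and> fst c' i < snd c' i \<and> snd c' i \<le> 1"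
    by linarith
qed

lemma box_inside_subset:
  assumes "proper_box I c" "inside_box I c c'"
  shows "arrow_box I c' \<subseteq> arrow_box I c"
proof -
  have "{arrow (fst c' i) 1..arrow (snd c' i) 0} \<subseteq> {arrow (fst c i) 1..arrow (snd c i) 0}" if "i \<in> I" for i
  proof -
    have "0 \<le> fst c i" "fst c i < fst c' i" "fst c' i < snd c' i" "snd c' i < snd c i" "snd c i \<le> 1"
      using assms that unfolding proper_box_def inside_box_def by blast+
    then show ?thesis by auto
  qed
  then show ?thesis
    unfolding arrow_box_def by blast
qed

text \<open>The Hider answers \<open>U\<close> whenever \<open>U\<close> meets the box, since a
  common point leads to a smaller box in one of its basic neighbourhoods. Otherwise the complement
  contains the whole box.\<close>

lemma hider_box_reply:
  assumes c: "proper_box I c" and U: "openin (double_arrow_power I) U"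
  obtains V c' where "V \<in> {U, topspace (double_arrow_power I) - U}" "inside_box I c c'" "arrow_box I c' \<subseteq> V"
proof (cases "U \<inter> arrow_box I c = {}")
  case True
  \<comment> \<open>Middle thirds: nothing has to be avoided here, but the strict shrinking must go
    on.\<close>
  define c' where "c' = (\<lambda>i. fst c i + (snd c i - fst c i) / 3, \<lambda>i. fst c i + 2 * (snd c i - fst c i) / 3)"
  have "inside_box I c c'"
    unfolding inside_box_def
  proof
    fix i
    assume "i \<in> I"
    then have "fst c i < snd c i"
      using c unfolding proper_box_def by blast
    then show "fst c i < fst c' i \<and> fst c' i < snd c' i \<and> snd c' i < snd c i"
      by (simp add: c'_def field_simps)
  qed
  moreover have "arrow_box I c' \<subseteq> topspace (double_arrow_power I) - U"
    using box_inside_subset[OF c \<open>inside_box I c c'\<close>] True unfolding arrow_box_def by blast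
  ultimately show thesis
    using that by blast
next
  case False
  then obtain x where x: "x \<in> U" "x \<in> arrow_box I c"
    by blast
  obtain F N where "finite F" and F: "F \<subseteq> I" and N: "\<forall>i\<in>I. open (N i) \<and> x i \<in> N i"
    and sub: "{y \<in> topspace (double_arrow_power I). \<forall>i\<in>F. y i \<in> N i} \<subseteq> U"
    by (rule basic_neighbourhood[OF U x(1)])
  have "\<exists>ab. fst c i < fst ab \<and> fst ab < snd ab \<and> snd ab < snd c i \<and>
      {arrow (fst ab) 1..arrow (snd ab) 0} \<subseteq> N i" if "i \<in> I" for i
  proof -
    have Ni: "open (N i)" "x i \<in> N i"
      using N that by blast+
    have xi: "x i \<in> {arrow (fst c i) 1..arrow (snd c i) 0}"
      using x(2) that unfolding arrow_box_def by blast
    have ci: "0 \<le> fst c i" "fst c i < snd c i" "snd c i \<le> 1"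
      using c that unfolding proper_box_def by blast+
    obtain a b where "fst c i < a" "a < b" "b < snd c i" "{arrow a 1..arrow b 0} \<subseteq> N i"
      by (rule shrinking_interval[OF Ni xi ci])
    then show ?thesis
      by (intro exI[of _ "(a, b)"]) simp
  qed
  then obtain ab where ab: "\<And>i. i \<in> I \<Longrightarrow> fst c i < fst (ab i) \<and> fst (ab i) < snd (ab i) \<and> snd (ab i) < snd c i \<and>
      {arrow (fst (ab i)) 1..arrow (snd (ab i)) 0} \<subseteq> N i"
    by metis
  define c' where "c' = (\<lambda>i. fst (ab i), \<lambda>i. snd (ab i))"
  have "inside_box I c c'"
    unfolding inside_box_def c'_def using ab by simp
  moreover have "arrow_box I c' \<subseteq> U"
  proof -
    have "{arrow (fst c' i) 1..arrow (snd c' i) 0} \<subseteq> N i" if "i \<in> F" for i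
      using ab[of i] F that by (auto simp: c'_def)
    then have "arrow_box I c' \<subseteq> {y \<in> topspace (double_arrow_power I). \<forall>i\<in>F. y i \<in> N i}"
      using F unfolding arrow_box_def by blast
    then show ?thesis
      using sub by blast
  qed
  ultimately show thesis
    using that by blast
qed

text \<open>The supremum of the left ends lies weakly between all ends. Applied to the next box,
  which is strictly inside, this makes both inequalities strict.\<close>

lemma nested_boxes:
  assumes c: "\<And>n. proper_box I (c n)" "\<And>n. inside_box I (c n) (c (Suc n))"
  obtains t where "\<forall>n. \<forall>i\<in>I. fst (c n) i < t i \<and> t i < snd (c n) i"
proof -
  have step: "fst (c n) i < fst (c (Suc n)) i" "snd (c (Suc n)) i < snd (c n) i" if "i \<in> I" for n i
    using c(2)[of n] that unfolding inside_box_def by blast+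
  have less: "fst (c n) i < snd (c n) i" if "i \<in> I" for n i
    using c(1)[of n] that unfolding proper_box_def by blast
  have inc: "fst (c n) i \<le> fst (c m) i" if "n \<le> m" "i \<in> I" for n m i
    using lift_Suc_mono_le[of "\<lambda>n. fst (c n) i", OF _ \<open>n \<le> m\<close>] step(1)[OF that(2)] less_imp_le by blast
  have dec: "snd (c m) i \<le> snd (c n) i" if "n \<le> m" "i \<in> I" for n m i
    using lift_Suc_antimono_le[of "\<lambda>n. snd (c n) i", OF _ \<open>n \<le> m\<close>] step(2)[OF that(2)] less_imp_le by blast
  have cross: "fst (c n) i \<le> snd (c m) i" if "i \<in> I" for n m i
    using inc[of n "max n m" i] less[of i "max n m"] dec[of m "max n m" i] that by simp
  define t where "t i = (SUP n. fst (c n) i)" for i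
  have lower: "fst (c n) i \<le> t i" if "i \<in> I" for n i
    unfolding t_def using cross[OF that, of _ 0] by (intro cSUP_upper bdd_aboveI2) auto
  have upper: "t i \<le> snd (c n) i" if "i \<in> I" for n i
    unfolding t_def using cross[OF that, of _ n] by (intro cSUP_least) auto
  show thesis
  proof (rule that, intro allI ballI)
    show "fst (c n) i < t i \<and> t i < snd (c n) i" if "i \<in> I" for n i
      using step[OF that, of n] lower[OF that, of "Suc n"] upper[OF that, of "Suc n"] by linarith
  qed
qed

lemma fibre_subset_box:
  assumes "proper_box I c" and t: "\<And>i. i \<in> I \<Longrightarrow> fst c i < t i \<and> t i < snd c i"
  shows "fibre I t \<subseteq> arrow_box I c"
proof
  fix y
  assume y: "y \<in> fibre I t"
  have "y i \<in> {arrow (fst c i) 1..arrow (snd c i) 0}" if "i \<in> I" for i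
  proof -
    have "pos (y i) = t i"
      using y that unfolding fibre_def by blast
    moreover have "0 \<le> fst c i" "fst c i < snd c i" "snd c i \<le> 1"
      using assms(1) that unfolding proper_box_def by blast+
    ultimately show ?thesis
      using arrow_interval_iff[of "fst c i" "snd c i" "y i"] t[OF that] by auto
  qed
  then show "y \<in> arrow_box I c"
    using y unfolding arrow_box_def fibre_def by blast
qed

text \<open>
  The boxes shrink strictly in every coordinate at every move, and not only in the finitely many
  coordinates restricted by the Seeker. Hence the limit stays away from all end points, and both
  points over each of its coordinates survive.
\<close>

lemma hider_keeps_fibre:
  assumes op: "\<forall>\<alpha>\<in>Field natLeq. \<forall>h. openin (double_arrow_power I) (\<sigma> \<alpha> h)"
  obtains U V t where "consistent_play (double_arrow_power I) natLeq \<sigma> U V"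
    "\<forall>i\<in>I. t i \<in> {0..1}" "fibre I t \<subseteq> game_outcome (double_arrow_power I) natLeq V"
proof -
  let ?X = "double_arrow_power I"
  \<comment> \<open>The initial box has the ends 0 and 1 in each coordinate; it omits only the
    isolated extreme points \<open>arrow 0 0\<close> and \<open>arrow 1 1\<close>.\<close>
  define previous :: "nat \<Rightarrow> (nat \<Rightarrow> ('a \<Rightarrow> real) \<times> ('a \<Rightarrow> real)) \<Rightarrow> ('a \<Rightarrow> real) \<times> ('a \<Rightarrow> real)"
    where "previous n D = (case n of 0 \<Rightarrow> (\<lambda>_. 0, \<lambda>_. 1) | Suc m \<Rightarrow> D m)" for n D
  \<comment> \<open>Conditional, since a reply is required for arbitrary earlier states;
    \<open>proper\<close> shows that the condition always holds in the play.\<close>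
  define Good where "Good n D V c \<longleftrightarrow>
      (proper_box I (previous n D) \<longrightarrow> inside_box I (previous n D) c \<and> arrow_box I c \<subseteq> V)" for n D V c
  have "\<exists>V c. V \<in> {U, topspace ?X - U} \<and> Good n D V c" if U: "openin ?X U" for n D U
  proof (cases "proper_box I (previous n D)")
    case True
    obtain V c where "V \<in> {U, topspace ?X - U}" "inside_box I (previous n D) c" "arrow_box I c \<subseteq> V"
      by (rule hider_box_reply[OF True U])
    then show ?thesis
      unfolding Good_def by blast
  next
    case False
    then show ?thesis
      unfolding Good_def by blast
  qed
  note answer = this
  obtain U V S where play: "consistent_play ?X natLeq \<sigma> U V"
    and good: "\<forall>n\<in>Field natLeq. Good n (restrict S (underS natLeq n)) (V n) (S n)"
    by (rule hider_play[OF natLeq_Well_order op, of Good]) (rule answer)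
  have prev: "previous n (restrict S (underS natLeq n)) = previous n S" for n
    unfolding previous_def underS_natLeq by (cases n) auto
  have good': "proper_box I (previous n S) \<Longrightarrow> inside_box I (previous n S) (S n) \<and> arrow_box I (S n) \<subseteq> V n" for n
    using bspec[OF good, of n] unfolding Good_def prev by (simp add: Field_natLeq)
  have proper: "proper_box I (previous n S)" for n
  proof (induction n)
    case 0
    show ?case
      by (simp add: previous_def proper_box_def)
  next
    case (Suc n)
    then have "proper_box I (S n)"
      using good'[OF Suc] proper_box_inside by blast
    then show ?case
      by (simp add: previous_def)
  qed
  have S: "proper_box I (S n)" "inside_box I (S n) (S (Suc n))" "arrow_box I (S n) \<subseteq> V n" for n
    using proper[of "Suc n"] good'[OF proper, of "Suc n"] good'[OF proper, of n] by (simp_all add: previous_def)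
  obtain t where "\<forall>n. \<forall>i\<in>I. fst (S n) i < t i \<and> t i < snd (S n) i"
    by (rule nested_boxes[of I S, OF S(1,2)])
  then have t: "fst (S n) i < t i \<and> t i < snd (S n) i" if "i \<in> I" for n i
    using that by blast
  show thesis
  proof (rule that[OF play])
    have "t i \<in> {0..1}" if "i \<in> I" for i
    proof -
      have "0 \<le> fst (S 0) i" "snd (S 0) i \<le> 1"
        using S(1)[of 0] that unfolding proper_box_def by blast+
      then show ?thesis
        using t[OF that, of 0] by simp
    qed
    then show "\<forall>i\<in>I. t i \<in> {0..1}"
      by blast
    have "fibre I t \<subseteq> V n" for n
      using fibre_subset_box[OF S(1) t] S(3) by blast
    then show "fibre I t \<subseteq> game_outcome ?X natLeq V"
      unfolding game_outcome_def fibre_def by blast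
  qed
qed

section \<open>Games shorter than the cardinal of the index set\<close>

text \<open>If \<open>U\<close> meets the cylinder of all earlier commitments, the Hider answers
  \<open>U\<close> and fixes finitely many coordinates to the values of a common point. Taking the
  point in that cylinder makes commitments from different moves agree, so that they unite to one
  partial function even after limit stages.\<close>

lemma hider_keeps_cylinder:
  fixes s :: "'b rel" and I :: "'i set"
  assumes I: "infinite I" and sI: "s <o |I|" and op: "\<forall>\<alpha>\<in>Field s. \<forall>h. openin (double_arrow_power I) (\<sigma> \<alpha> h)"
  obtains U V J g where "consistent_play (double_arrow_power I) s \<sigma> U V"
    "|J| <o |I|" "J \<subseteq> I"
    "{z \<in> topspace (double_arrow_power I). \<forall>i\<in>J. z i = g i} \<subseteq> game_outcome (double_arrow_power I) s V"
proof -
  let ?X = "double_arrow_power I"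
  have s: "Well_order s"
    using sI by (simp add: ordLess_def)
  define C :: "'b \<Rightarrow> ('b \<Rightarrow> 'i set \<times> ('i \<Rightarrow> double_arrow)) \<Rightarrow> ('i \<Rightarrow> double_arrow) set" where
    "C \<alpha> D = {z \<in> topspace ?X. \<forall>\<gamma>\<in>underS s \<alpha>. \<forall>i\<in>fst (D \<gamma>). z i = snd (D \<gamma>) i}" for \<alpha> D
  \<comment> \<open>\<open>fst c\<close> holds the coordinates committed at this move and
    \<open>snd c\<close> a point with their values. A point is required only for nonempty
    \<open>fst c\<close>, because answering with the complement commits nothing and supplies no
    point.\<close>
  define Good where "Good \<alpha> D V c \<longleftrightarrow> finite (fst c) \<and> fst c \<subseteq> I \<and>
      (fst c \<noteq> {} \<longrightarrow> snd c \<in> C \<alpha> D) \<and> {z \<in> C \<alpha> D. \<forall>i\<in>fst c. z i = snd c i} \<subseteq> V" for \<alpha> D V c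
  have answer: "\<exists>V c. V \<in> {U, topspace ?X - U} \<and> Good \<alpha> D V c" if U: "openin ?X U" for \<alpha> D U
  proof (cases "U \<inter> C \<alpha> D = {}")
    case True
    then have "C \<alpha> D \<subseteq> topspace ?X - U"
      unfolding C_def by blast
    then have "Good \<alpha> D (topspace ?X - U) ({}, undefined)"
      by (simp add: Good_def)
    then show ?thesis by blast
  next
    case False
    then obtain x where x: "x \<in> U" "x \<in> C \<alpha> D"
      by blast
    obtain F where F: "finite F" "F \<subseteq> I" "{y \<in> topspace ?X. \<forall>i\<in>F. y i = x i} \<subseteq> U"
      by (rule cylinder_in_open[OF U x(1)])
    have "C \<alpha> D \<subseteq> topspace ?X"
      unfolding C_def by blast
    then have "{z \<in> C \<alpha> D. \<forall>i\<in>F. z i = x i} \<subseteq> U"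
      using F(3) by blast
    then have "Good \<alpha> D U (F, x)"
      using F x by (simp add: Good_def)
    then show ?thesis by blast
  qed
  obtain U V S where play: "consistent_play ?X s \<sigma> U V"
    and good: "\<forall>\<alpha>\<in>Field s. Good \<alpha> (restrict S (underS s \<alpha>)) (V \<alpha>) (S \<alpha>)"
    by (rule hider_play[OF s op, of Good]) (rule answer)
  have C: "C \<alpha> (restrict S (underS s \<alpha>)) = C \<alpha> S" for \<alpha>
    unfolding C_def by auto
  have fin: "finite (fst (S \<alpha>))" and sub: "fst (S \<alpha>) \<subseteq> I"
    and inC: "fst (S \<alpha>) \<noteq> {} \<Longrightarrow> snd (S \<alpha>) \<in> C \<alpha> S"
    and V: "{z \<in> C \<alpha> S. \<forall>i\<in>fst (S \<alpha>). z i = snd (S \<alpha>) i} \<subseteq> V \<alpha>"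
    if "\<alpha> \<in> Field s" for \<alpha>
    using bspec[OF good that] unfolding Good_def C by blast+
  have agree_less: "snd (S \<alpha>) i = snd (S \<beta>) i"
    if "\<alpha> \<in> Field s" "\<beta> \<in> underS s \<alpha>" "i \<in> fst (S \<alpha>)" "i \<in> fst (S \<beta>)" for \<alpha> \<beta> i
  proof -
    have "snd (S \<alpha>) \<in> C \<alpha> S"
      using inC[OF that(1)] that(3) by blast
    then show ?thesis
      using that unfolding C_def by blast
  qed
  have agree: "snd (S \<alpha>) i = snd (S \<beta>) i"
    if "\<alpha> \<in> Field s" "\<beta> \<in> Field s" "i \<in> fst (S \<alpha>)" "i \<in> fst (S \<beta>)" for \<alpha> \<beta> i
  proof -
    have "total_on (Field s) s"
      using s by (simp add: order_on_defs)
    then have "\<alpha> = \<beta> \<or> \<beta> \<in> underS s \<alpha> \<or> \<alpha> \<in> underS s \<beta>"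
      using that unfolding total_on_def underS_def by blast
    then consider "\<alpha> = \<beta>" | "\<beta> \<in> underS s \<alpha>" | "\<alpha> \<in> underS s \<beta>"
      by blast
    then show ?thesis
    proof cases
      case 1
      then show ?thesis by simp
    next
      case 2
      show ?thesis
        by (rule agree_less[OF that(1) 2 that(3,4)])
    next
      case 3
      show ?thesis
        by (rule agree_less[OF that(2) 3 that(4,3), symmetric])
    qed
  qed
  define J where "J = (\<Union>\<alpha>\<in>Field s. fst (S \<alpha>))"
  \<comment> \<open>Any move that committed \<open>i\<close> may be chosen: by \<open>agree\<close>
    all of them give the same value.\<close>
  define stage where "stage i = (SOME \<alpha>. \<alpha> \<in> Field s \<and> i \<in> fst (S \<alpha>))" for i
  define g where "g i = snd (S (stage i)) i" for i
  have g: "g i = snd (S \<alpha>) i" if "\<alpha> \<in> Field s" "i \<in> fst (S \<alpha>)" for \<alpha> i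
  proof -
    have "stage i \<in> Field s \<and> i \<in> fst (S (stage i))"
      unfolding stage_def by (rule someI[of _ \<alpha>]) (simp add: that)
    then show ?thesis
      unfolding g_def using agree that by blast
  qed
  show thesis
  proof (rule that[OF play])
    show "J \<subseteq> I"
      unfolding J_def using sub by blast
    show "|J| <o |I|"
    \<comment> \<open>For finite \<open>s\<close> the union may outgrow \<open>Field s\<close>, but
      it is finite while \<open>I\<close> is not.\<close>
    proof (cases "finite (Field s)")
      case True
      then have "finite J"
        unfolding J_def using fin by blast
      then show ?thesis
        using I by (intro finite_ordLess_infinite card_of_Well_order) (simp_all add: Field_card_of)
    next
      case False
      have "|fst (S \<alpha>)| \<le>o |Field s|" if "\<alpha> \<in> Field s" for \<alpha>
        using fin[OF that] False
        by (intro ordLess_imp_ordLeq finite_ordLess_infinite card_of_Well_order) (simp_all add: Field_card_of)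
      then have "|J| \<le>o |Field s|"
        unfolding J_def using False ordLeq_reflexive[OF card_of_Well_order]
        by (intro card_of_UNION_ordLeq_infinite) blast+
      also have "|Field s| \<le>o s"
        using card_of_least s by blast
      finally show ?thesis
        using sI by (rule ordLeq_ordLess_trans)
    qed
    show "{z \<in> topspace ?X. \<forall>i\<in>J. z i = g i} \<subseteq> game_outcome ?X s V"
    proof
      fix z
      assume z: "z \<in> {z \<in> topspace ?X. \<forall>i\<in>J. z i = g i}"
      have zS: "z i = snd (S \<alpha>) i" if "\<alpha> \<in> Field s" "i \<in> fst (S \<alpha>)" for \<alpha> i
        using z g[OF that] that unfolding J_def by auto
      have "z \<in> V \<alpha>" if "\<alpha> \<in> Field s" for \<alpha>
      proof -
        have "\<gamma> \<in> Field s" if "\<gamma> \<in> underS s \<alpha>" for \<gamma>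
          using that by (auto simp: underS_def intro: FieldI1)
        then have "z \<in> C \<alpha> S"
          using z zS unfolding C_def by blast
        then show ?thesis
          using V[OF that] zS[OF that] by blast
      qed
      then show "z \<in> game_outcome ?X s V"
        using z unfolding game_outcome_def by blast
    qed
  qed
qed

text \<open>Prescribing fewer than \<open>|I|\<close> coordinates leaves open how many differ from
  \<open>arrow 0 0\<close>: the others can be filled with \<open>arrow 0 0\<close> or with
  \<open>arrow 0 1\<close>.\<close>

lemma not_seeker_wins_short_game:
  fixes s :: "'b rel" and I :: "'i set"
  assumes I: "infinite I" and s: "s <o |I|"
  shows "\<not> seeker_wins (double_arrow_power I)
    (deciding_sets {z \<in> topspace (double_arrow_power I). |{i \<in> I. z i \<noteq> arrow 0 0}| <o |I| }) s"
proof
  let ?X = "double_arrow_power I"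
  let ?Y = "{z \<in> topspace ?X. |{i \<in> I. z i \<noteq> arrow 0 0}| <o |I| }"
  assume "seeker_wins ?X (deciding_sets ?Y) s"
  then obtain \<sigma> where op: "\<forall>\<alpha>\<in>Field s. \<forall>h. openin ?X (\<sigma> \<alpha> h)"
    and win: "\<forall>U V. consistent_play ?X s \<sigma> U V \<longrightarrow> game_outcome ?X s V \<in> deciding_sets ?Y"
    unfolding seeker_wins_def by blast
  obtain U V J g where play: "consistent_play ?X s \<sigma> U V"
    and JI: "|J| <o |I|" and J: "J \<subseteq> I"
    and out: "{z \<in> topspace ?X. \<forall>i\<in>J. z i = g i} \<subseteq> game_outcome ?X s V"
    by (rule hider_keeps_cylinder[OF I s op])
  define z where "z k = (\<lambda>i\<in>I. if i \<in> J then g i else arrow 0 k)" for k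
  have zX: "z k \<in> topspace ?X" for k
    by (simp add: z_def)
  have "\<forall>i\<in>J. z k i = g i" for k
    using J by (auto simp: z_def)
  then have z: "z k \<in> game_outcome ?X s V" for k
    using out zX by blast
  have "{i \<in> I. z 0 i \<noteq> arrow 0 0} \<subseteq> J"
    by (auto simp: z_def)
  then have "|{i \<in> I. z 0 i \<noteq> arrow 0 0}| <o |I|"
    using JI by (meson card_of_mono1 ordLeq_ordLess_trans)
  then have "z 0 \<in> ?Y"
    using zX by blast
  moreover have "z 1 \<notin> ?Y"
  proof
    assume "z 1 \<in> ?Y"
    then have "|{i \<in> I. z 1 i \<noteq> arrow 0 0}| <o |I|"
      by blast
    \<comment> \<open>\<open>z 1\<close> differs from \<open>arrow 0 0\<close> on all of
      \<open>I - J\<close>, and an infinite set is not the union of two sets of smaller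
      cardinality.\<close>
    then have "|{i \<in> I. z 1 i \<noteq> arrow 0 0} \<union> J| <o |I|"
      using card_of_Un_ordLess_infinite[OF I _ JI] by blast
    moreover have "I \<subseteq> {i \<in> I. z 1 i \<noteq> arrow 0 0} \<union> J"
      by (auto simp: z_def)
    ultimately have "|I| <o |I|"
      by (meson card_of_mono1 ordLeq_ordLess_trans)
    then show False
      using ordLess_irreflexive by blast
  qed
  moreover have "game_outcome ?X s V \<in> deciding_sets ?Y"
    using win play by blast
  ultimately show False
    using z unfolding deciding_sets_def by blast
qed

section \<open>Lower bounds for omega + m moves\<close>

text \<open>Joins the fibre saved in the first omega moves with backward induction over the other
  \<open>m\<close>. The outcome is only known to contain the fibre, so \<open>Q m\<close> is asked
  of all supersets; \<open>Q\<close> may depend on \<open>t\<close>, which the play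
  determines.\<close>

lemma not_seeker_wins_if_fibre_invariant:
  assumes fibre: "\<And>t. \<forall>i\<in>I. t i \<in> {0..1} \<Longrightarrow> \<exists>Q. (\<forall>W. fibre I t \<subseteq> W \<longrightarrow> Q m W) \<and> (\<forall>L. Q 0 L \<longrightarrow> L \<notin> P) \<and>
      (\<forall>k L U. Q (Suc k) L \<longrightarrow> openin (double_arrow_power I) U \<longrightarrow> Q k (L \<inter> U) \<or> Q k (L - U))"
  shows "\<not> seeker_wins (double_arrow_power I) P (ordinal_sum natLeq (natLeq_on m))"
proof
  let ?X = "double_arrow_power I"
  assume "seeker_wins ?X P (ordinal_sum natLeq (natLeq_on m))"
  then have "seeker_wins ?X ((before_move ?X ^^ m) P) natLeq"
    using seeker_wins_finitely_many_moves[OF natLeq_Well_order] by blast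
  then obtain \<sigma> where op: "\<forall>\<alpha>\<in>Field natLeq. \<forall>h. openin ?X (\<sigma> \<alpha> h)"
    and win: "\<forall>U V. consistent_play ?X natLeq \<sigma> U V \<longrightarrow> game_outcome ?X natLeq V \<in> (before_move ?X ^^ m) P"
    unfolding seeker_wins_def by blast
  obtain U V t where play: "consistent_play ?X natLeq \<sigma> U V"
    and t: "\<forall>i\<in>I. t i \<in> {0..1}" and out: "fibre I t \<subseteq> game_outcome ?X natLeq V"
    by (rule hider_keeps_fibre[OF op])
  obtain Q where Q: "\<forall>W. fibre I t \<subseteq> W \<longrightarrow> Q m W" "\<forall>L. Q 0 L \<longrightarrow> L \<notin> P"
      "\<forall>k L U. Q (Suc k) L \<longrightarrow> openin ?X U \<longrightarrow> Q k (L \<inter> U) \<or> Q k (L - U)"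
    using fibre[OF t] by blast
  have "game_outcome ?X natLeq V \<notin> (before_move ?X ^^ m) P"
  proof (rule not_before_moves_if_invariant[of Q])
    show "Q m (game_outcome ?X natLeq V)"
      using Q(1) out by blast
    show "L \<notin> P" if "Q 0 L" for L
      using Q(2) that by blast
    show "Q k (L \<inter> U) \<or> Q k (L - U)" if "Q (Suc k) L" "openin ?X U" for k L U
      using Q(3) that by blast
  qed
  then show False
    using win play by blast
qed

lemma not_seeker_wins_separating_finite:
  assumes I: "finite I" "m < card I"
  shows "\<not> seeker_wins (double_arrow_power I) separating_sets (ordinal_sum natLeq (natLeq_on m))"
proof (rule not_seeker_wins_if_fibre_invariant)
  fix t :: "'a \<Rightarrow> real"
  assume t: "\<forall>i\<in>I. t i \<in> {0..1}"
  \<comment> \<open>With \<open>k\<close> moves to go, at least \<open>2 ^ Suc k\<close> points are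
    kept: each move at most halves them, and two remain at \<open>k = 0\<close>. The fibre starts
    with \<open>2 ^ card I\<close> points, hence the bound on \<open>m\<close>.\<close>
  define Q where "Q k L \<longleftrightarrow> (\<exists>K. K \<subseteq> L \<and> finite K \<and> 2 ^ Suc k \<le> card K)"
    for k and L :: "('a \<Rightarrow> double_arrow) set"
  have fib: "fibre I t = (\<Pi>\<^sub>E i\<in>I. {arrow (t i) 0, arrow (t i) 1})"
    using t by (intro fibre_eq_PiE) blast
  have "card {arrow (t i) 0, arrow (t i) 1} = 2" if "i \<in> I" for i
    using t that by (simp add: card_2_iff')
  then have "card (fibre I t) = 2 ^ card I"
    unfolding fib using I by (simp add: card_PiE)
  moreover have "2 ^ Suc m \<le> (2 :: nat) ^ card I"
    using I(2) by (intro power_increasing) auto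
  moreover have "finite (fibre I t)"
    unfolding fib using I by (intro finite_PiE) auto
  ultimately have "Q m W" if "fibre I t \<subseteq> W" for W
    unfolding Q_def using that by (intro exI[of _ "fibre I t"]) simp
  moreover have "L \<notin> separating_sets" if "Q 0 L" for L
  proof
    assume "L \<in> separating_sets"
    then have L: "finite L" "card L \<le> 1"
      by (simp_all add: separating_sets_def)
    obtain K where K: "K \<subseteq> L" "2 \<le> card K"
      using \<open>Q 0 L\<close> unfolding Q_def by auto
    show False
      using card_mono[OF L(1) K(1)] K(2) L(2) by linarith
  qed
  moreover have "Q k (L \<inter> U) \<or> Q k (L - U)" if "Q (Suc k) L" for k L U
  proof -
    obtain K where K: "K \<subseteq> L" "finite K" "2 ^ Suc (Suc k) \<le> card K"
      using \<open>Q (Suc k) L\<close> unfolding Q_def by blast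
    have "card K = card (K \<inter> U) + card (K - U)"
      using K(2) by (metis card_Int_Diff add.commute)
    then have "2 ^ Suc k \<le> card (K \<inter> U) \<or> 2 ^ Suc k \<le> card (K - U)"
      using K(3) by auto
    moreover have "K \<inter> U \<subseteq> L \<inter> U" "K - U \<subseteq> L - U" "finite (K \<inter> U)" "finite (K - U)"
      using K by auto
    ultimately show ?thesis
      unfolding Q_def by blast
  qed
  ultimately show "\<exists>Q. (\<forall>W. fibre I t \<subseteq> W \<longrightarrow> Q m W) \<and> (\<forall>L. Q 0 L \<longrightarrow> L \<notin> separating_sets) \<and>
      (\<forall>k L U. Q (Suc k) L \<longrightarrow> openin (double_arrow_power I) U \<longrightarrow> Q k (L \<inter> U) \<or> Q k (L - U))"
    by (intro exI[of _ Q]) blast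
qed

definition lower_points :: "'i set \<Rightarrow> 'i \<Rightarrow> ('i \<Rightarrow> double_arrow) set" where
  "lower_points I i = {z \<in> topspace (double_arrow_power I). z i = arrow (pos (z i)) 0}"

text \<open>A fibre contains its all-lower and its all-upper point, and
  \<open>lower_points I i\<close> tells them apart. Adding \<open>natLeq_on 0\<close> gives omega
  the form omega + k used for all excluded lengths.\<close>

lemma not_seeker_wins_deciding_omega:
  assumes i: "i \<in> I"
  shows "\<not> seeker_wins (double_arrow_power I) (deciding_sets (lower_points I i)) (ordinal_sum natLeq (natLeq_on 0))"
proof (rule not_seeker_wins_if_fibre_invariant)
  fix t :: "'a \<Rightarrow> real"
  assume t: "\<forall>i\<in>I. t i \<in> {0..1}"
  \<comment> \<open>The conjunct \<open>k = 0\<close> makes the step clause vacuous, as no move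
    follows.\<close>
  define Q :: "nat \<Rightarrow> ('a \<Rightarrow> double_arrow) set \<Rightarrow> bool"
    where "Q k L \<longleftrightarrow> k = 0 \<and> fibre I t \<subseteq> L" for k L
  have "L \<notin> deciding_sets (lower_points I i)" if L: "fibre I t \<subseteq> L" for L
  proof -
    have fib: "fibre I t = (\<Pi>\<^sub>E i\<in>I. {arrow (t i) 0, arrow (t i) 1})"
      using t by (intro fibre_eq_PiE) blast
    define z where "z k = (\<lambda>i\<in>I. arrow (t i) k)" for k
    have "z 0 \<in> L" "z 1 \<in> L"
      using L unfolding fib z_def by auto
    moreover have "z 0 \<in> lower_points I i" "z 1 \<notin> lower_points I i"
      using i t by (auto simp: z_def lower_points_def)
    ultimately show ?thesis
      unfolding deciding_sets_def by blast
  qed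
  then show "\<exists>Q. (\<forall>W. fibre I t \<subseteq> W \<longrightarrow> Q 0 W) \<and> (\<forall>L. Q 0 L \<longrightarrow> L \<notin> deciding_sets (lower_points I i)) \<and>
      (\<forall>k L U. Q (Suc k) L \<longrightarrow> openin (double_arrow_power I) U \<longrightarrow> Q k (L \<inter> U) \<or> Q k (L - U))"
    by (intro exI[of _ Q]) (auto simp: Q_def)
qed

text \<open>A tail set: within the space, changing finitely many coordinates does not affect
  membership.\<close>

definition almost_lower_points :: "'i set \<Rightarrow> ('i \<Rightarrow> double_arrow) set" where
  "almost_lower_points I =
     {z \<in> topspace (double_arrow_power I). finite {i \<in> I. z i \<noteq> arrow (pos (z i)) 0}}"

lemma not_seeker_wins_deciding_infinite:
  assumes I: "infinite I"
  shows "\<not> seeker_wins (double_arrow_power I) (deciding_sets (almost_lower_points I))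
    (ordinal_sum natLeq (natLeq_on m))"
proof (rule not_seeker_wins_if_fibre_invariant)
  let ?X = "double_arrow_power I"
  fix t :: "'a \<Rightarrow> real"
  assume t: "\<forall>i\<in>I. t i \<in> {0..1}"
  \<comment> \<open>The promise is the same for all \<open>k\<close>: the outcome contains a
    nonempty cylinder of the fibre given by finitely many coordinates. A further move at most
    enlarges \<open>F\<close>.\<close>
  define Q :: "nat \<Rightarrow> ('a \<Rightarrow> double_arrow) set \<Rightarrow> bool" where "Q k L \<longleftrightarrow>
      (\<exists>y F. finite F \<and> y \<in> fibre I t \<and> {z \<in> fibre I t. \<forall>i\<in>F. z i = y i} \<subseteq> L)" for k L
  have fib: "fibre I t = (\<Pi>\<^sub>E i\<in>I. {arrow (t i) 0, arrow (t i) 1})"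
    using t by (intro fibre_eq_PiE) blast
  have ne: "(\<lambda>i\<in>I. arrow (t i) 0) \<in> fibre I t"
    unfolding fib by auto
  have start: "Q m W" if "fibre I t \<subseteq> W" for W
    unfolding Q_def
  proof (intro exI conjI)
    show "finite {}" ..
    show "(\<lambda>i\<in>I. arrow (t i) 0) \<in> fibre I t"
      by (rule ne)
    show "{z \<in> fibre I t. \<forall>i\<in>{}. z i = (\<lambda>i\<in>I. arrow (t i) 0) i} \<subseteq> W"
      using that by blast
  qed
  have final: "L \<notin> deciding_sets (almost_lower_points I)" if "Q 0 L" for L
  proof -
    obtain y F where F: "finite F" and y: "y \<in> fibre I t" "{z \<in> fibre I t. \<forall>i\<in>F. z i = y i} \<subseteq> L"
      using \<open>Q 0 L\<close> unfolding Q_def by blast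
    \<comment> \<open>The free coordinates are filled with lower points for \<open>k = 0\<close> and
      with upper points for \<open>k = 1\<close>; both completions stay in the cylinder.\<close>
    define z where "z k = (\<lambda>i\<in>I. if i \<in> F then y i else arrow (t i) k)" for k
    have yi: "y i \<in> {arrow (t i) 0, arrow (t i) 1}" if "i \<in> I" for i
      using y(1) that unfolding fib by (auto simp: PiE_iff)
    have yu: "y i = undefined" if "i \<notin> I" for i
      using y(1) that unfolding fib by (auto simp: PiE_iff extensional_def)
    have zf: "z k \<in> fibre I t" if "k \<in> {0, 1}" for k
      unfolding fib using yi that by (auto simp: z_def PiE_iff)
    moreover have "\<forall>i\<in>F. z k i = y i" for k
      using yu by (auto simp: z_def)
    ultimately have zL: "z k \<in> L" if "k \<in> {0, 1}" for k
      using y(2) that by blast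
    have zX: "z k \<in> topspace ?X" for k
      by (simp add: z_def)
    have "{i \<in> I. z 0 i \<noteq> arrow (pos (z 0 i)) 0} \<subseteq> F"
      using t by (auto simp: z_def)
    then have "z 0 \<in> almost_lower_points I"
      using zX F finite_subset unfolding almost_lower_points_def by blast
    moreover have "z 1 \<notin> almost_lower_points I"
    proof
      assume "z 1 \<in> almost_lower_points I"
      then have "finite {i \<in> I. z 1 i \<noteq> arrow (pos (z 1 i)) 0}"
        unfolding almost_lower_points_def by blast
      moreover have "I - F \<subseteq> {i \<in> I. z 1 i \<noteq> arrow (pos (z 1 i)) 0}"
        using t by (auto simp: z_def)
      ultimately have "finite (I - F)"
        using finite_subset by blast
      then show False
        using I F by simp
    qed
    ultimately show ?thesis
      using zL[of 0] zL[of 1] unfolding deciding_sets_def by blast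
  qed
  have step: "Q k (L \<inter> U) \<or> Q k (L - U)" if QL: "Q (Suc k) L" and U: "openin ?X U" for k L U
  proof -
    obtain y F where F: "finite F" and y: "y \<in> fibre I t" "{z \<in> fibre I t. \<forall>i\<in>F. z i = y i} \<subseteq> L"
      using QL unfolding Q_def by blast
    show ?thesis
    proof (cases "{z \<in> fibre I t. \<forall>i\<in>F. z i = y i} \<inter> U = {}")
      case True
      then have "{z \<in> fibre I t. \<forall>i\<in>F. z i = y i} \<subseteq> L - U"
        using y(2) by blast
      then have "Q k (L - U)"
        unfolding Q_def using F y(1) by blast
      then show ?thesis ..
    next
      case False
      then obtain x where x: "x \<in> U" "x \<in> fibre I t" "\<forall>i\<in>F. x i = y i"
        by blast
      obtain G where G: "finite G" "G \<subseteq> I" "{z \<in> topspace ?X. \<forall>i\<in>G. z i = x i} \<subseteq> U"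
        by (rule cylinder_in_open[OF U x(1)])
      have "{z \<in> fibre I t. \<forall>i\<in>F \<union> G. z i = x i} \<subseteq> L \<inter> U"
      proof
        fix z
        assume z: "z \<in> {z \<in> fibre I t. \<forall>i\<in>F \<union> G. z i = x i}"
        then have "\<forall>i\<in>F. z i = y i"
          using x(3) by simp
        then have "z \<in> L"
          using y(2) z by blast
        moreover have "z \<in> topspace ?X"
          using z unfolding fibre_def by blast
        then have "z \<in> U"
          using G(3) z by blast
        ultimately show "z \<in> L \<inter> U" ..
      qed
      then have "Q k (L \<inter> U)"
        unfolding Q_def using F G(1) x(2) by (intro exI[of _ x] exI[of _ "F \<union> G"]) simp
      then show ?thesis ..
    qed
  qed
  show "\<exists>Q. (\<forall>W. fibre I t \<subseteq> W \<longrightarrow> Q m W) \<and> (\<forall>L. Q 0 L \<longrightarrow> L \<notin> deciding_sets (almost_lower_points I)) \<and>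
      (\<forall>k L U. Q (Suc k) L \<longrightarrow> openin ?X U \<longrightarrow> Q k (L \<inter> U) \<or> Q k (L - U))"
    using start final step by (intro exI[of _ Q] conjI allI impI)
qed

section \<open>The values of the invariants\<close>

lemma t0_double_arrow_power: "t0_space (double_arrow_power I)"
  by (rule Hausdorff_imp_t0_space[OF Hausdorff_double_arrow_power])

section \<open>From games to bounds on the invariants\<close>

text \<open>A winning length below omega + t would be at most some omega + k, and padding would make
  the Seeker win there.\<close>

lemma ordinal_sum_ordLeq_if_seeker_loses:
  assumes t: "t = natLeq \<or> t = natLeq_on n"
    and lose: "\<And>k. k = 0 \<or> k \<in> Field t \<Longrightarrow> \<not> seeker_wins X P (ordinal_sum natLeq (natLeq_on k))"
    and down: "\<And>W W'. W \<in> P \<Longrightarrow> W' \<subseteq> W \<Longrightarrow> W' \<in> P"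
    and s: "Well_order s" "seeker_wins X P s"
  shows "ordinal_sum natLeq t \<le>o s"
proof (rule ccontr)
  have "Well_order t"
    using t natLeq_Well_order natLeq_on_Well_order by auto
  then have wt: "Well_order (ordinal_sum natLeq t)"
    by (rule Well_order_ordinal_sum[OF natLeq_Well_order])
  assume "\<not> ordinal_sum natLeq t \<le>o s"
  then have "s <o ordinal_sum natLeq t"
    using not_ordLeq_iff_ordLess[OF s(1) wt] by blast
  then obtain k where k: "k = 0 \<or> k \<in> Field t" "s \<le>o ordinal_sum natLeq (natLeq_on k)"
    by (rule ordLess_ordinal_sum_natLeq[OF _ t])
  have "seeker_wins X P (ordinal_sum natLeq (natLeq_on k))"
    using k(2) s(2) by (rule seeker_wins_longer) (rule down)
  then show False
    using lose[OF k(1)] by blast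
qed

text \<open>An outcome with at most one point decides every \<open>Y\<close>.\<close>

lemma sm_ordLeq_ps:
  assumes "t0_space X"
  shows "sm X \<le>o ps X"
proof (rule sm_least(3)[OF assms ps_least(1)[OF assms]])
  show "sm_in Y X \<le>o ps X" for Y
    by (rule sm_in_least(3)[OF assms ps_least(1)[OF assms]
      seeker_wins_mono[OF ps_least(2)[OF assms] separating_subset_deciding]])
qed

lemma ordLeq_sm:
  assumes X: "t0_space X" and Y: "Y \<subseteq> topspace X"
    and bound: "\<And>s :: 'a set rel. Well_order s \<Longrightarrow> seeker_wins X (deciding_sets Y) s \<Longrightarrow> r \<le>o s"
  shows "r \<le>o sm (X :: 'a topology)"
  using bound[OF sm_in_least(1,2)[OF X, of Y]] sm_least(2)[OF X Y] by (rule ordLeq_transitive)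

lemma ps_countable_ordLeq:
  assumes "countable I" "I \<noteq> {}"
  shows "ps (double_arrow_power I) \<le>o ordinal_sum natLeq |I|"
  by (rule ps_least(3)[OF t0_double_arrow_power
      Well_order_ordinal_sum[OF natLeq_Well_order card_of_Well_order]
      seeker_wins_separating_countable[OF assms]])

section \<open>The three cardinality cases\<close>

text \<open>The chain from \<open>|I|\<close> through \<open>sm\<close> and \<open>ps\<close> back
  to \<open>|I|\<close> closes, so both values follow at once.\<close>

lemma invariants_uncountable:
  assumes I: "natLeq <o |I|"
  shows "ps (double_arrow_power I) =o |I|" "sm (double_arrow_power I) =o |I|"
proof -
  let ?X = "double_arrow_power I"
  have inf: "infinite I"
    using infinite_iff_natLeq_ordLeq[of I] ordLess_imp_ordLeq[OF I] by blast
  have "ps ?X \<le>o |I|"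
    by (rule ps_least(3)[OF t0_double_arrow_power card_of_Well_order seeker_wins_separating_uncountable[OF I]])
  moreover have "|I| \<le>o sm ?X"
  proof (rule ordLeq_sm[OF t0_double_arrow_power])
    let ?Y = "{z \<in> topspace ?X. |{i \<in> I. z i \<noteq> arrow 0 0}| <o |I| }"
    show "?Y \<subseteq> topspace ?X"
      by blast
    show "|I| \<le>o s" if s: "Well_order s" "seeker_wins ?X (deciding_sets ?Y) s" for s :: "('a \<Rightarrow> double_arrow) set rel"
    proof (rule ccontr)
      assume "\<not> |I| \<le>o s"
      then have "s <o |I|"
        using not_ordLeq_iff_ordLess[OF s(1) card_of_Well_order] by blast
      then show False
        using not_seeker_wins_short_game[OF inf] s(2) by blast
    qed
  qed
  moreover have "sm ?X \<le>o ps ?X"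
    by (rule sm_ordLeq_ps[OF t0_double_arrow_power])
  ultimately show "ps ?X =o |I|" "sm ?X =o |I|"
    unfolding ordIso_iff_ordLeq using ordLeq_transitive by blast+
qed

lemma invariants_countably_infinite:
  assumes I: "|I| =o natLeq"
  shows "ps (double_arrow_power I) =o ordinal_sum natLeq |I|"
    "sm (double_arrow_power I) =o ordinal_sum natLeq natLeq"
proof -
  let ?X = "double_arrow_power I"
  have inf: "infinite I"
    using infinite_iff_natLeq_ordLeq[of I] ordIso_imp_ordLeq[OF ordIso_symmetric[OF I]] by blast
  then have ne: "I \<noteq> {}"
    by blast
  have "|I| \<le>o |UNIV :: nat set|"
    using ordIso_imp_ordLeq[OF I] ordIso_symmetric[OF card_of_nat] by (rule ordLeq_ordIso_trans)
  then have "countable I"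
    unfolding card_of_ordLeq[symmetric] countable_def by blast
  then have ps_le: "ps ?X \<le>o ordinal_sum natLeq |I|"
    using ne by (rule ps_countable_ordLeq)
  have sum: "ordinal_sum natLeq |I| =o ordinal_sum natLeq natLeq"
    by (rule ordinal_sum_ordIso_right[OF natLeq_Well_order I])
  have sm_ge: "ordinal_sum natLeq natLeq \<le>o sm ?X"
  proof (rule ordLeq_sm[OF t0_double_arrow_power])
    show "almost_lower_points I \<subseteq> topspace ?X"
      unfolding almost_lower_points_def by blast
    show "ordinal_sum natLeq natLeq \<le>o s"
      if "Well_order s" "seeker_wins ?X (deciding_sets (almost_lower_points I)) s" for s :: "('a \<Rightarrow> double_arrow) set rel"
    proof (rule ordinal_sum_ordLeq_if_seeker_loses[OF _ _ _ that])
      show "natLeq = natLeq \<or> natLeq = natLeq_on 0"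
        by simp
      show "\<not> seeker_wins ?X (deciding_sets (almost_lower_points I)) (ordinal_sum natLeq (natLeq_on k))" for k
        by (rule not_seeker_wins_deciding_infinite[OF inf])
    qed (rule deciding_sets_subset)
  qed
  have sm_ps: "sm ?X \<le>o ps ?X"
    by (rule sm_ordLeq_ps[OF t0_double_arrow_power])
  have "ordinal_sum natLeq |I| \<le>o ps ?X"
    by (rule ordIso_ordLeq_trans[OF sum ordLeq_transitive[OF sm_ge sm_ps]])
  then show "ps ?X =o ordinal_sum natLeq |I|"
    unfolding ordIso_iff_ordLeq using ps_le by blast
  have "sm ?X \<le>o ordinal_sum natLeq natLeq"
    by (rule ordLeq_ordIso_trans[OF ordLeq_transitive[OF sm_ps ps_le] sum])
  then show "sm ?X =o ordinal_sum natLeq natLeq"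
    unfolding ordIso_iff_ordLeq using sm_ge by blast
qed

lemma finite_card_of_ordIso_natLeq_on:
  assumes "finite A"
  shows "|A| =o natLeq_on (card A)"
proof -
  have "\<exists>f. bij_betw f A {x. x < card A}"
    using assms by (intro finite_same_card_bij) simp_all
  then have "|A| =o |{x. x < card A}|"
    using card_of_ordIso by blast
  also have "|{x. x < card A}| =o natLeq_on (card A)"
    by (rule finite_well_order_on_ordIso[OF _ card_of_well_order_on natLeq_on_well_order_on]) simp
  finally show ?thesis .
qed

text \<open>With several coordinates the two values differ, so comparing \<open>sm\<close> with
  \<open>ps\<close> cannot give both, and each gets its own upper and lower bound.\<close>

lemma invariants_finite:
  assumes I: "finite I" "I \<noteq> {}"
  shows "ps (double_arrow_power I) =o ordinal_sum natLeq |I|"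
    "sm (double_arrow_power I) =o ordinal_sum natLeq (natLeq_on 1)"
proof -
  let ?X = "double_arrow_power I"
  \<comment> \<open>A successor, as \<open>I\<close> is nonempty: thus the alternative
    \<open>k = 0\<close> in the list of excluded lengths is also less than
    \<open>card I\<close>.\<close>
  obtain m where m: "card I = Suc m"
    using I by (metis card_gt_0_iff gr0_implies_Suc)
  have "|I| =o natLeq_on (card I)"
    by (rule finite_card_of_ordIso_natLeq_on[OF I(1)])
  then have sum: "ordinal_sum natLeq |I| =o ordinal_sum natLeq (natLeq_on (Suc m))"
    unfolding m by (rule ordinal_sum_ordIso_right[OF natLeq_Well_order])
  have "ordinal_sum natLeq (natLeq_on (Suc m)) \<le>o ps ?X"
  proof (rule ordinal_sum_ordLeq_if_seeker_loses[OF _ _ _ ps_least(1,2)[OF t0_double_arrow_power]])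
    show "natLeq_on (Suc m) = natLeq \<or> natLeq_on (Suc m) = natLeq_on (Suc m)"
      by (rule disjI2[OF refl])
    show "\<not> seeker_wins ?X separating_sets (ordinal_sum natLeq (natLeq_on k))"
      if "k = 0 \<or> k \<in> Field (natLeq_on (Suc m))" for k
    proof (rule not_seeker_wins_separating_finite[OF I(1)])
      show "k < card I"
        using that unfolding Field_natLeq_on m by auto
    qed
  qed (rule separating_sets_subset)
  then show "ps ?X =o ordinal_sum natLeq |I|"
    unfolding ordIso_iff_ordLeq[of "ps ?X"]
    using ps_countable_ordLeq[OF countable_finite[OF I(1)] I(2)] ordIso_ordLeq_trans[OF sum] by blast
  obtain i where i: "i \<in> I"
    using I(2) by blast
  have "ordinal_sum natLeq (natLeq_on 1) \<le>o sm ?X"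
  proof (rule ordLeq_sm[OF t0_double_arrow_power])
    show "lower_points I i \<subseteq> topspace ?X"
      unfolding lower_points_def by blast
    show "ordinal_sum natLeq (natLeq_on 1) \<le>o s"
      if "Well_order s" "seeker_wins ?X (deciding_sets (lower_points I i)) s" for s :: "('a \<Rightarrow> double_arrow) set rel"
    proof (rule ordinal_sum_ordLeq_if_seeker_loses[OF _ _ _ that])
      show "natLeq_on 1 = natLeq \<or> natLeq_on 1 = natLeq_on 1"
        by (rule disjI2[OF refl])
      show "\<not> seeker_wins ?X (deciding_sets (lower_points I i)) (ordinal_sum natLeq (natLeq_on k))"
        if "k = 0 \<or> k \<in> Field (natLeq_on 1)" for k
      proof -
        have "k = 0"
          using that unfolding Field_natLeq_on by auto
        then show ?thesis
          using not_seeker_wins_deciding_omega[OF i] by blast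
      qed
    qed (rule deciding_sets_subset)
  qed
  moreover have "sm ?X \<le>o ordinal_sum natLeq (natLeq_on 1)"
  proof (rule sm_least(3)[OF t0_double_arrow_power Well_order_ordinal_sum[OF natLeq_Well_order natLeq_on_Well_order]])
    show "sm_in Y ?X \<le>o ordinal_sum natLeq (natLeq_on 1)" for Y
      by (rule sm_in_least(3)[OF t0_double_arrow_power
          Well_order_ordinal_sum[OF natLeq_Well_order natLeq_on_Well_order] seeker_wins_deciding_finite[OF I]])
  qed
  ultimately show "sm ?X =o ordinal_sum natLeq (natLeq_on 1)"
    unfolding ordIso_iff_ordLeq by blast
qed

theorem theorem4p3:
  fixes I :: "'i set"
  assumes "I \<noteq> {}"
  shows "( |I| \<le>o natLeq \<longrightarrow> ps (double_arrow_power I) =o ordinal_sum natLeq |I| ) \<and>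
         (natLeq <o |I| \<longrightarrow> ps (double_arrow_power I) =o |I| ) \<and>
         ( |I| <o natLeq \<longrightarrow> sm (double_arrow_power I) =o ordinal_sum natLeq (natLeq_on 1)) \<and>
         ( |I| =o natLeq \<longrightarrow> sm (double_arrow_power I) =o ordinal_sum natLeq natLeq) \<and>
         (natLeq <o |I| \<longrightarrow> sm (double_arrow_power I) =o |I| )"
proof (intro conjI impI)
  have finite: "finite I" if "|I| <o natLeq"
    using that infinite_iff_natLeq_ordLeq[of I] not_ordLess_ordLeq by blast
  show "ps (double_arrow_power I) =o ordinal_sum natLeq |I|" if "|I| \<le>o natLeq"
    using that finite invariants_finite(1)[OF _ assms] invariants_countably_infinite(1)
    unfolding ordLeq_iff_ordLess_or_ordIso by blast
  show "sm (double_arrow_power I) =o ordinal_sum natLeq (natLeq_on 1)" if "|I| <o natLeq"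
    by (rule invariants_finite(2)[OF finite[OF that] assms])
qed (fact invariants_uncountable invariants_countably_infinite(2))+

end
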